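(* The algorithm $\mathtt{PLUQ}$ described in the context, run on an $m\times n$ matrix of rank $r$ over a field, performs $O(mnr^{\omega-2})$ field operations, where $\omega$ is the exponent of matrix multiplication.
   Context: $\omega$ denotes the exponent of matrix multiplication: two $s\times s$ matrices over the field are multiplied with $O(s^\omega)$ field operations (arithmetic operations in the field). Matrix products in the algorithm are computed with this fast multiplication, so that a product of an $a\times s$ by an $s\times b$ matrix with $s\le\min(a,b)$ costs $O(ab\,s^{\omega-2})$; products by the inverse of a triangular matrix ($L_1^{-1}B_1$, $C_1U_1^{-1}$, etc.) are computed by triangular system solving reduced to matrix multiplication, with cost $O(b\,s^{\omega-1})$ for an $s\times s$ triangular matrix and $b\geq s$ right-hand sides. Permutations cost no field operations. Blocks may have zero dimensions; the product of an $a\times 0$ matrix by a $0\times b$ matrix is the $a\times b$ zero matrix, and a matrix with no rows or no columns is decomposed trivially with rank $0$ and identity permutations. $T_{1,i}$ is the permutation matrix of the transposition of the indices $1$ and $i$ (identity if $i=1$). $\mathrm{Diag}$ denotes a block diagonal matrix. Algorithm $\mathtt{PLUQ}$ on an $m\times n$ matrix $A$ returns permutation matrices $P$ ($m\times m$), $Q$ ($n\times n$), the rank $r$ of $A$, and $L$ ($r\times r$ unit lower triangular), $M$ ($(m-r)\times r$), $U$ ($r\times r$ upper triangular), $V$ ($r\times(n-r)$) with $A=P\begin{bmatrix}L\\ M\end{bmatrix}[U\ V]Q$, as follows: Base case $m=1$. If $A=0$: $P=[1]$, $Q=I_n$, $r=0$. Otherwise let $i$ be the column index of the first nonzero entry: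 $P=[1]$, $Q=T_{1,i}$, $r=1$, $L=[1]$, $M$ empty, $[U\ V]=A\,T_{1,i}$. Base case $n=1$. If $A=0$: $P=I_m$, $Q=[1]$, $r=0$. Otherwise let $i$ be the row index of the first nonzero entry $a_i$: $P=T_{1,i}$, $Q=[1]$, $r=1$, $U=[a_i]$, $V$ empty, $\begin{bmatrix}L\\ M\end{bmatrix}=T_{1,i}A\,a_i^{-1}$ (only the entries of $A$ after position $i$ need to be divided by $a_i$). Otherwise put $k=\lfloor m/2\rfloor$, $h=\lfloor n/2\rfloor$ and split $A=\begin{bmatrix}A_1&A_2\\ A_3&A_4\end{bmatrix}$ with $A_1$ of size $k\times h$. 1. Recursively decompose $A_1=P_1\begin{bmatrix}L_1\\ M_1\end{bmatrix}[U_1\ V_1]Q_1$, of rank $r_1$. 2. Set $\begin{bmatrix}B_1\\ B_2\end{bmatrix}=P_1^TA_2$ ($B_1$ with $r_1$ rows), $[C_1\ C_2]=A_3Q_1^T$ ($C_1$ with $r_1$ columns), $D=L_1^{-1}B_1$, $E=C_1U_1^{-1}$, $F=B_2-M_1D$, $G=C_2-EV_1$, $H=A_4-ED$. 3. Recursively decompose $F=P_2\begin{bmatrix}L_2\\ M_2\end{bmatrix}[U_2\ V_2]Q_2$ (rank $r_2$) and $G=P_3\begin{bmatrix}L_3\\ M_3\end{bmatrix}[U_3\ V_3]Q_3$ (rank $r_3$). 4. Set $\begin{bmatrix}H_1&H_2\\ H_3&H_4\end{bmatrix}=P_3^THQ_2^T$ ($H_1$ of size $r_3\times r_2$), $\begin{bmatrix}E_1\\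 E_2\end{bmatrix}=P_3^TE$ ($E_1$ with $r_3$ rows), $\begin{bmatrix}M_{11}\\ M_{12}\end{bmatrix}=P_2^TM_1$ ($M_{11}$ with $r_2$ rows), $[D_1\ D_2]=DQ_2^T$ ($D_1$ with $r_2$ columns), $[V_{11}\ V_{12}]=V_1Q_3^T$ ($V_{11}$ with $r_3$ columns). 5. Set $X=H_1U_2^{-1}$, $J=L_3^{-1}X$, $K=H_3U_2^{-1}$, $N=L_3^{-1}H_2$, $O=N-JV_2$, $W=H_4-KV_2-M_3O$. 6. Recursively decompose $W=P_4\begin{bmatrix}L_4\\ M_4\end{bmatrix}[U_4\ V_4]Q_4$ (rank $r_4$). Set $\begin{bmatrix}E_{21}&M_{31}&K_1\\ E_{22}&M_{32}&K_2\end{bmatrix}=P_4^T[E_2\ M_3\ K]$ (top blocks with $r_4$ rows) and $\begin{bmatrix}D_{21}&D_{22}\\ V_{21}&V_{22}\\ O_1&O_2\end{bmatrix}=\begin{bmatrix}D_2\\ V_2\\ O\end{bmatrix}Q_4^T$ (left blocks with $r_4$ columns). 7. Set $$S=\begin{bmatrix}I_{r_1+r_2}&0&0&0\\ 0&0&I_{k-r_1-r_2}&0\\ 0&I_{r_3+r_4}&0&0\\ 0&0&0&I_{m-k-r_3-r_4}\end{bmatrix},\quad T=\begin{bmatrix}I_{r_1}&0&0&0&0&0\\ 0&0&0&I_{r_2}&0&0\\ 0&I_{r_3}&0&0&0&0\\ 0&0&0&0&I_{r_4}&0\\ 0&0&I_{h-r_1-r_3}&0&0&0\\ 0&0&0&0&0&I_{n-h-r_2-r_4}\end{bmatrix},$$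 $P=\mathrm{Diag}\big(P_1\mathrm{Diag}(I_{r_1},P_2),\,P_3\mathrm{Diag}(I_{r_3},P_4)\big)S$ and $Q=T\,\mathrm{Diag}\big(\mathrm{Diag}(I_{r_1},Q_3)Q_1,\,\mathrm{Diag}(I_{r_2},Q_4)Q_2\big)$. 8. Return $P$, $Q$, $r=r_1+r_2+r_3+r_4$ and $$L=\begin{bmatrix}L_1&0&0&0\\ M_{11}&L_2&0&0\\ E_1&X&L_3&0\\ E_{21}&K_1&M_{31}&L_4\end{bmatrix},\ M=\begin{bmatrix}M_{12}&M_2&0&0\\ E_{22}&K_2&M_{32}&M_4\end{bmatrix},$$ $$U=\begin{bmatrix}U_1&D_1&V_{11}&D_{21}\\ 0&U_2&0&V_{21}\\ 0&0&U_3&O_1\\ 0&0&0&U_4\end{bmatrix},\ V=\begin{bmatrix}V_{12}&D_{22}\\ 0&V_{22}\\ V_3&O_2\\ 0&V_4\end{bmatrix}.$$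
   Formalization: The formal theorem assumes ω > 2 (at ω = 2 the subtractions alone can cost about mn log r, so the claimed bound fails), and subtracting a product of inner dimension 0 counts as free. *)

theory Defs
  imports Complex_Main "HOL-Library.Monad_Syntax" "Jordan_Normal_Form.DL_Rank"
begin

section \<open>Straight-line programs over a field\<close>

text \<open>Every instruction appends one register. Only \<open>Add\<close>, \<open>Sub\<close>, \<open>Mul\<close> and \<open>Div\<close> count as field
  operations. Division is total (\<open>x / 0 = 0\<close>).\<close>

datatype 'a instr =
    is_Const: Const 'a
  | Add nat nat
  | Sub nat nat
  | Mul nat nat
  | Div nat nat

text \<open>The second component lists the registers that are returned.\<close>

type_synonym 'a slp = "'a instr list \<times> nat list"

fun instr_value :: "'a::field instr \<Rightarrow> 'a list \<Rightarrow> 'a" where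
  "instr_value (Const c) xs = c"
| "instr_value (Add i j) xs = xs ! i + xs ! j"
| "instr_value (Sub i j) xs = xs ! i - xs ! j"
| "instr_value (Mul i j) xs = xs ! i * xs ! j"
| "instr_value (Div i j) xs = xs ! i / xs ! j"

definition slp_eval :: "'a::field slp \<Rightarrow> 'a list \<Rightarrow> 'a list" where
  "slp_eval p xs =
     (let regs = foldl (\<lambda>ys ins. ys @ [instr_value ins ys]) xs (fst p)
      in map (\<lambda>i. regs ! i) (snd p))"

definition slp_ops :: "'a slp \<Rightarrow> nat" where
  "slp_ops p = length (filter (\<lambda>ins. \<not> is_Const ins) (fst p))"


section \<open>Results paired with the number of field operations spent\<close>

type_synonym 'x counted = "'x \<times> nat"

definition bind_counted :: "'x counted \<Rightarrow> ('x \<Rightarrow> 'y counted) \<Rightarrow> 'y counted" where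
  "bind_counted x f = (let (y, c) = x; (z, d) = f y in (z, c + d))"

adhoc_overloading Monad_Syntax.bind \<rightleftharpoons> bind_counted

definition ret :: "'x \<Rightarrow> 'x counted" where
  "ret x = (x, 0)"

definition spend :: "nat \<Rightarrow> unit counted" where
  "spend k = ((), k)"


section \<open>Blocks\<close>

definition split_rows :: "'a mat \<Rightarrow> nat \<Rightarrow> 'a mat \<times> 'a mat" where
  "split_rows A r = (case split_block A r (dim_col A) of (A1, _, A3, _) \<Rightarrow> (A1, A3))"

definition split_cols :: "'a mat \<Rightarrow> nat \<Rightarrow> 'a mat \<times> 'a mat" where
  "split_cols A c = (case split_block A (dim_row A) c of (A1, A2, _, _) \<Rightarrow> (A1, A2))"

fun vcat :: "'a::zero mat list \<Rightarrow> 'a mat" where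
  "vcat [] = 0\<^sub>m 0 0"
| "vcat [A] = A"
| "vcat (A # B # Cs) = A @\<^sub>r vcat (B # Cs)"

definition append_cols :: "'a::zero mat \<Rightarrow> 'a mat \<Rightarrow> 'a mat" where
  "append_cols A B = four_block_mat A B (0\<^sub>m 0 (dim_col A)) (0\<^sub>m 0 (dim_col B))"

fun hcat :: "'a::zero mat list \<Rightarrow> 'a mat" where
  "hcat [] = 0\<^sub>m 0 0"
| "hcat [A] = A"
| "hcat (A # B # Cs) = append_cols A (hcat (B # Cs))"

definition block_mat :: "'a::zero mat list list \<Rightarrow> 'a mat" where
  "block_mat Ass = vcat (map hcat Ass)"

text \<open>Zero padding, or truncation to the leading block.\<close>

definition resize :: "nat \<Rightarrow> nat \<Rightarrow> 'a::zero mat \<Rightarrow> 'a mat" where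
  "resize a b A = mat a b (\<lambda>(i, j). if i < dim_row A \<and> j < dim_col A then A $$ (i, j) else 0)"


section \<open>Matrix multiplication and triangular solving routines\<close>

definition entries :: "'a mat \<Rightarrow> 'a list" where
  "entries A = concat (mat_to_list A)"

text \<open>Runs \<open>p\<close> on the entries of \<open>A\<close> followed by those of \<open>B\<close> (row by row) and reads an
  \<open>a \<times> b\<close> matrix off the output.\<close>

definition slp_mat :: "'a::field slp \<Rightarrow> nat \<Rightarrow> nat \<Rightarrow> 'a mat \<Rightarrow> 'a mat \<Rightarrow> 'a mat counted" where
  "slp_mat p a b A B =
     (let ys = slp_eval p (entries A @ entries B)
      in (mat a b (\<lambda>(i, j). ys ! (i * b + j)), slp_ops p))"

text \<open>\<open>mm a s b\<close> multiplies \<open>a \<times> s\<close> by \<open>s \<times> b\<close> matrices, \<open>s \<le> min a b\<close>. For \<open>a = b = s\<close> the bound is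
  \<open>c s\<^sup>\<omega>\<close>. For \<open>\<omega> > 2\<close> a product with inner dimension \<open>0\<close> is free, since \<open>0 powr (\<omega> - 2) = 0\<close>.\<close>

definition mm_routine :: "real \<Rightarrow> (nat \<Rightarrow> nat \<Rightarrow> nat \<Rightarrow> 'a::field slp) \<Rightarrow> bool" where
  "mm_routine \<omega> mm \<longleftrightarrow>
     (\<forall>a s b. s \<le> min a b \<longrightarrow>
        (\<forall>A \<in> carrier_mat a s. \<forall>B \<in> carrier_mat s b. fst (slp_mat (mm a s b) a b A B) = A * B)) \<and>
     (\<exists>c. \<forall>a s b. s \<le> min a b \<longrightarrow>
        real (slp_ops (mm a s b)) \<le> c * real a * real b * real s powr (\<omega> - 2))"

definition unit_lower_triangular :: "'a::{zero,one} mat \<Rightarrow> bool" where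
  "unit_lower_triangular L \<longleftrightarrow>
     upper_triangular (transpose_mat L) \<and> (\<forall>i < dim_row L. L $$ (i, i) = 1)"

text \<open>\<open>lsolve s b\<close> computes \<open>L\<inverse> B\<close> for \<open>b\<close> right-hand sides (the columns of \<open>B\<close>), \<open>b \<ge> s\<close>.\<close>

definition lower_solve_routine :: "real \<Rightarrow> (nat \<Rightarrow> nat \<Rightarrow> 'a::field slp) \<Rightarrow> bool" where
  "lower_solve_routine \<omega> lsolve \<longleftrightarrow>
     (\<forall>s b. s \<le> b \<longrightarrow>
        (\<forall>L \<in> carrier_mat s s. \<forall>B \<in> carrier_mat s b. unit_lower_triangular L \<longrightarrow>
           L * fst (slp_mat (lsolve s b) s b L B) = B)) \<and>
     (\<exists>c. \<forall>s b. s \<le> b \<longrightarrow> real (slp_ops (lsolve s b)) \<le> c * real b * real s powr (\<omega> - 1))"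

text \<open>\<open>usolve s b\<close> computes \<open>C U\<inverse>\<close> for \<open>b\<close> right-hand sides (the rows of \<open>C\<close>), \<open>b \<ge> s\<close>.\<close>

definition upper_solve_routine :: "real \<Rightarrow> (nat \<Rightarrow> nat \<Rightarrow> 'a::field slp) \<Rightarrow> bool" where
  "upper_solve_routine \<omega> usolve \<longleftrightarrow>
     (\<forall>s b. s \<le> b \<longrightarrow>
        (\<forall>C \<in> carrier_mat b s. \<forall>U \<in> carrier_mat s s.
           upper_triangular U \<and> (\<forall>i < s. U $$ (i, i) \<noteq> 0) \<longrightarrow>
           fst (slp_mat (usolve s b) b s C U) * U = C)) \<and>
     (\<exists>c. \<forall>s b. s \<le> b \<longrightarrow> real (slp_ops (usolve s b)) \<le> c * real b * real s powr (\<omega> - 1))"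


section \<open>The algorithm\<close>

text \<open>The three routines above, in this order. Shapes that they do not cover are padded with zeros.\<close>

type_synonym 'a routines =
  "(nat \<Rightarrow> nat \<Rightarrow> nat \<Rightarrow> 'a slp) \<times> (nat \<Rightarrow> nat \<Rightarrow> 'a slp) \<times> (nat \<Rightarrow> nat \<Rightarrow> 'a slp)"

fun mul_counted :: "'a::field routines \<Rightarrow> 'a mat \<Rightarrow> 'a mat \<Rightarrow> 'a mat counted" where
  "mul_counted (mm, lsolve, usolve) A B =
     (let s = dim_col A; a = max s (dim_row A); b = max s (dim_col B) in do {
        X \<leftarrow> slp_mat (mm a s b) a b (resize a s A) (resize s b B);
        ret (resize (dim_row A) (dim_col B) X)
      })"

fun lsolve_counted :: "'a::field routines \<Rightarrow> 'a mat \<Rightarrow> 'a mat \<Rightarrow> 'a mat counted" where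
  "lsolve_counted (mm, lsolve, usolve) L B =
     (let s = dim_row L; b = max s (dim_col B) in do {
        X \<leftarrow> slp_mat (lsolve s b) s b L (resize s b B);
        ret (resize s (dim_col B) X)
      })"

fun usolve_counted :: "'a::field routines \<Rightarrow> 'a mat \<Rightarrow> 'a mat \<Rightarrow> 'a mat counted" where
  "usolve_counted (mm, lsolve, usolve) C U =
     (let s = dim_row U; b = max s (dim_row C) in do {
        X \<leftarrow> slp_mat (usolve s b) b s (resize b s C) U;
        ret (resize (dim_row C) s X)
      })"

text \<open>\<open>C - A B\<close>, with one operation per entry for the subtraction. If the inner dimension is \<open>0\<close>,
  the product is the zero matrix by convention and \<open>C\<close> is returned without any operation.
  (If empty products were subtracted, already the zero \<open>n \<times> n\<close> matrix would take about \<open>n\<^sup>2 log n\<close>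
  operations.)\<close>

definition sub_mul_counted ::
  "'a::field routines \<Rightarrow> 'a mat \<Rightarrow> 'a mat \<Rightarrow> 'a mat \<Rightarrow> 'a mat counted" where
  "sub_mul_counted R C A B =
     (if dim_col A = 0 then ret C
      else do {
        X \<leftarrow> mul_counted R A B;
        spend (dim_row C * dim_col C);
        ret (C - X)
      })"

text \<open>The output \<open>(P, Q, r, L, M, U, V)\<close>.\<close>

type_synonym 'a pluq = "'a mat \<times> 'a mat \<times> nat \<times> 'a mat \<times> 'a mat \<times> 'a mat \<times> 'a mat"

definition pluq_zero :: "nat \<Rightarrow> nat \<Rightarrow> 'a::field pluq" where
  "pluq_zero m n = (1\<^sub>m m, 1\<^sub>m n, 0, 0\<^sub>m 0 0, 0\<^sub>m m 0, 0\<^sub>m 0 0, 0\<^sub>m 0 n)"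

text \<open>With indices starting at \<open>0\<close>, \<open>T\<^sub>1\<^sub>,\<^sub>i\<close> is \<open>swaprows_mat _ 0 i\<close>.\<close>

definition pluq_row :: "nat \<Rightarrow> 'a::field mat \<Rightarrow> 'a pluq counted" where
  "pluq_row n A =
     (if A = 0\<^sub>m 1 n then ret (pluq_zero 1 n)
      else let i = (LEAST j. j < n \<and> A $$ (0, j) \<noteq> 0);
               T = swaprows_mat n 0 i;
               (U, V) = split_cols (A * T) 1
           in ret (1\<^sub>m 1, T, 1, 1\<^sub>m 1, 0\<^sub>m 0 1, U, V))"

text \<open>Only the \<open>m - 1 - i\<close> entries below the pivot have to be divided: after the swap the first entry
  is the pivot, and the entries above it are zero.\<close>

definition pluq_col :: "nat \<Rightarrow> 'a::field mat \<Rightarrow> 'a pluq counted" where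
  "pluq_col m A =
     (if A = 0\<^sub>m m 1 then ret (pluq_zero m 1)
      else let i = (LEAST j. j < m \<and> A $$ (j, 0) \<noteq> 0);
               a = A $$ (i, 0);
               T = swaprows_mat m 0 i;
               (L, M) = split_rows (map_mat (\<lambda>x. x / a) (T * A)) 1
           in do {
             spend (m - 1 - i);
             ret (T, 1\<^sub>m 1, 1, L, M, mat 1 1 (\<lambda>_. a), 0\<^sub>m 1 0)
           })"

text \<open>The block permutation matrices of the last step, where \<open>k'\<close>, \<open>m'\<close>, \<open>h'\<close>, \<open>n'\<close> are the orders
  \<open>k - r\<^sub>1 - r\<^sub>2\<close>, \<open>m - k - r\<^sub>3 - r\<^sub>4\<close>, \<open>h - r\<^sub>1 - r\<^sub>3\<close>, \<open>n - h - r\<^sub>2 - r\<^sub>4\<close> of the remaining identity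
  blocks.\<close>

definition pluq_S :: "nat \<Rightarrow> nat \<Rightarrow> nat \<Rightarrow> nat \<Rightarrow> 'a::field mat" where
  "pluq_S r12 r34 k' m' = block_mat
     [[1\<^sub>m r12, 0\<^sub>m r12 r34, 0\<^sub>m r12 k', 0\<^sub>m r12 m'],
      [0\<^sub>m k' r12, 0\<^sub>m k' r34, 1\<^sub>m k', 0\<^sub>m k' m'],
      [0\<^sub>m r34 r12, 1\<^sub>m r34, 0\<^sub>m r34 k', 0\<^sub>m r34 m'],
      [0\<^sub>m m' r12, 0\<^sub>m m' r34, 0\<^sub>m m' k', 1\<^sub>m m']]"

definition pluq_T :: "nat \<Rightarrow> nat \<Rightarrow> nat \<Rightarrow> nat \<Rightarrow> nat \<Rightarrow> nat \<Rightarrow> 'a::field mat" where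
  "pluq_T r1 r2 r3 r4 h' n' = block_mat
     [[1\<^sub>m r1, 0\<^sub>m r1 r3, 0\<^sub>m r1 h', 0\<^sub>m r1 r2, 0\<^sub>m r1 r4, 0\<^sub>m r1 n'],
      [0\<^sub>m r2 r1, 0\<^sub>m r2 r3, 0\<^sub>m r2 h', 1\<^sub>m r2, 0\<^sub>m r2 r4, 0\<^sub>m r2 n'],
      [0\<^sub>m r3 r1, 1\<^sub>m r3, 0\<^sub>m r3 h', 0\<^sub>m r3 r2, 0\<^sub>m r3 r4, 0\<^sub>m r3 n'],
      [0\<^sub>m r4 r1, 0\<^sub>m r4 r3, 0\<^sub>m r4 h', 0\<^sub>m r4 r2, 1\<^sub>m r4, 0\<^sub>m r4 n'],
      [0\<^sub>m h' r1, 0\<^sub>m h' r3, 1\<^sub>m h', 0\<^sub>m h' r2, 0\<^sub>m h' r4, 0\<^sub>m h' n'],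
      [0\<^sub>m n' r1, 0\<^sub>m n' r3, 0\<^sub>m n' h', 0\<^sub>m n' r2, 0\<^sub>m n' r4, 1\<^sub>m n']]"

text \<open>\<open>pluq R m n A\<close> is meant for \<open>m \<times> n\<close> matrices \<open>A\<close>. Products with permutation matrices are free.\<close>

function pluq :: "'a::field routines \<Rightarrow> nat \<Rightarrow> nat \<Rightarrow> 'a mat \<Rightarrow> 'a pluq counted" where
  "pluq R m n A =
     (if m = 0 \<or> n = 0 then ret (pluq_zero m n)
      else if m = 1 then pluq_row n A
      else if n = 1 then pluq_col m A
      else
        let k = m div 2; h = n div 2;
            (A1, A2, A3, A4) = split_block A k h
        in do {
          (P1, Q1, r1, L1, M1, U1, V1) \<leftarrow> pluq R k h A1;
          let (B1, B2) = split_rows (transpose_mat P1 * A2) r1;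
          let (C1, C2) = split_cols (A3 * transpose_mat Q1) r1;
          D \<leftarrow> lsolve_counted R L1 B1;
          E \<leftarrow> usolve_counted R C1 U1;
          F \<leftarrow> sub_mul_counted R B2 M1 D;
          G \<leftarrow> sub_mul_counted R C2 E V1;
          H \<leftarrow> sub_mul_counted R A4 E D;
          (P2, Q2, r2, L2, M2, U2, V2) \<leftarrow> pluq R (k - r1) (n - h) F;
          (P3, Q3, r3, L3, M3, U3, V3) \<leftarrow> pluq R (m - k) (h - r1) G;
          let (H1, H2, H3, H4) = split_block (transpose_mat P3 * H * transpose_mat Q2) r3 r2;
          let (E1, E2) = split_rows (transpose_mat P3 * E) r3;
          let (M11, M12) = split_rows (transpose_mat P2 * M1) r2;
          let (D1, D2) = split_cols (D * transpose_mat Q2) r2;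
          let (V11, V12) = split_cols (V1 * transpose_mat Q3) r3;
          X \<leftarrow> usolve_counted R H1 U2;
          J \<leftarrow> lsolve_counted R L3 X;
          K \<leftarrow> usolve_counted R H3 U2;
          N \<leftarrow> lsolve_counted R L3 H2;
          O' \<leftarrow> sub_mul_counted R N J V2;
          W' \<leftarrow> sub_mul_counted R H4 K V2;
          W \<leftarrow> sub_mul_counted R W' M3 O';
          (P4, Q4, r4, L4, M4, U4, V4) \<leftarrow> pluq R (m - k - r3) (n - h - r2) W;
          let (E21, E22) = split_rows (transpose_mat P4 * E2) r4;
          let (M31, M32) = split_rows (transpose_mat P4 * M3) r4;
          let (K1, K2) = split_rows (transpose_mat P4 * K) r4;
          let (D21, D22) = split_cols (D2 * transpose_mat Q4) r4;
          let (V21, V22) = split_cols (V2 * transpose_mat Q4) r4;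
          let (O1, O2) = split_cols (O' * transpose_mat Q4) r4;
          let k' = k - r1 - r2;
          let m' = m - k - r3 - r4;
          let h' = h - r1 - r3;
          let n' = n - h - r2 - r4;
          let S = pluq_S (r1 + r2) (r3 + r4) k' m';
          let T = pluq_T r1 r2 r3 r4 h' n';
          let P = diag_block_mat [P1 * diag_block_mat [1\<^sub>m r1, P2],
                                  P3 * diag_block_mat [1\<^sub>m r3, P4]] * S;
          let Q = T * diag_block_mat [diag_block_mat [1\<^sub>m r1, Q3] * Q1,
                                      diag_block_mat [1\<^sub>m r2, Q4] * Q2];
          let L = block_mat
           [[L1, 0\<^sub>m r1 r2, 0\<^sub>m r1 r3, 0\<^sub>m r1 r4],
            [M11, L2, 0\<^sub>m r2 r3, 0\<^sub>m r2 r4],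
            [E1, X, L3, 0\<^sub>m r3 r4],
            [E21, K1, M31, L4]];
          let M = block_mat
           [[M12, M2, 0\<^sub>m k' r3, 0\<^sub>m k' r4],
            [E22, K2, M32, M4]];
          let U = block_mat
           [[U1, D1, V11, D21],
            [0\<^sub>m r2 r1, U2, 0\<^sub>m r2 r3, V21],
            [0\<^sub>m r3 r1, 0\<^sub>m r3 r2, U3, O1],
            [0\<^sub>m r4 r1, 0\<^sub>m r4 r2, 0\<^sub>m r4 r3, U4]];
          let V = block_mat
           [[V12, D22],
            [0\<^sub>m r2 h', V22],
            [V3, O2],
            [0\<^sub>m r4 h', V4]];
          ret (P, Q, r1 + r2 + r3 + r4, L, M, U, V)
        })"
  by pat_completeness auto
termination
  by (relation "measure (\<lambda>(R, m, n, A). m + n)") auto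

declare pluq.simps [simp del]

end

theory Submission
  imports Defs
begin

text \<open>
  Write \<open>\<beta> = \<omega> - 2\<close>. Every product and every triangular solve in one call of the algorithm has one of
  the ranks \<open>r\<^sub>1, \<dots>, r\<^sub>4\<close> as its inner dimension and outer dimensions of at most \<open>m\<close> and \<open>n\<close>. So the
  twelve of them cost at most a constant times \<open>m n r\<^sup>\<beta>\<close>, where \<open>r = r\<^sub>1 + r\<^sub>2 + r\<^sub>3 + r\<^sub>4\<close> is the returned
  rank (\<open>pluq_step\<close>). The four recursive calls work on parts of the four quadrants of the matrix. A
  quadrant is at most the fraction \<open>4 / 9\<close> of the whole, the worst case being the rounding of \<open>3 / 2\<close>
  to \<open>2\<close> in both directions. If \<open>p\<^sub>i\<close> is the fraction of the \<open>i\<close>-th quadrant and \<open>x\<^sub>i = r\<^sub>i / r\<close>, then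
  \<open>p\<^sub>1 + \<dots> + p\<^sub>4 \<le> 1\<close>, \<open>x\<^sub>1 + \<dots> + x\<^sub>4 = 1\<close>, and concavity gives
  \<open>p\<^sub>1 x\<^sub>1\<^sup>\<beta> + \<dots> + p\<^sub>4 x\<^sub>4\<^sup>\<beta> \<le> \<theta>\<close> with \<open>\<theta> = (4 / 9) powr min \<beta> 1 < 1\<close> (\<open>weighted_powr_sum_le\<close>). The
  recursive calls thus use only a fixed fraction \<open>\<theta>\<close> of the claimed bound and leave room for the cost of
  the current level: the recurrence is solved by \<open>C m n r\<^sup>\<beta>\<close> with a constant \<open>C\<close> (\<open>pluq_ops\<close>).
  For \<open>r = 0\<close> both sides vanish, since every routine called has inner dimension \<open>0\<close> and is free.

  This bounds the cost by the rank that the algorithm returns. It remains to see that the algorithm does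
  not return more than the true rank, and here its correctness is needed. By induction the output
  satisfies \<open>A = P [L; M] [U V] Q\<close> with \<open>P\<close> and \<open>Q\<close> orthogonal, \<open>L\<close> unit lower triangular and \<open>U\<close> upper
  triangular without zeros on the diagonal (\<open>pluq_correct\<close>); the block computation behind the induction
  step is \<open>pluq_assemble\<close>. The first \<open>r\<close> columns of \<open>A Q\<^sup>T\<close> are then those of \<open>P [L; M] U\<close>. They are
  linearly independent, so \<open>r\<close> is at most the rank of \<open>A\<close> (\<open>pluq_spec_rank\<close>).
\<close>

section \<open>Block matrices\<close>

text \<open>The side conditions below are equations between dimensions instead of memberships in
  \<^const>\<open>carrier_mat\<close>: the simplifier can then discharge them while it rewrites nested blocks.\<close>

notation append_cols (infixr \<open>@\<^sub>c\<close> 65)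

lemma dim_append_rows [simp]:
  "dim_row (A @\<^sub>r B) = dim_row A + dim_row B" "dim_col (A @\<^sub>r B) = dim_col A"
  by (simp_all add: append_rows_def)

lemma dim_append_cols [simp]:
  "dim_row (A @\<^sub>c B) = dim_row A" "dim_col (A @\<^sub>c B) = dim_col A + dim_col B"
  by (simp_all add: append_cols_def)

lemma index_append_rows [simp]:
  "i < dim_row A + dim_row B \<Longrightarrow> j < dim_col A \<Longrightarrow>
     (A @\<^sub>r B) $$ (i, j) = (if i < dim_row A then A $$ (i, j) else B $$ (i - dim_row A, j))"
  by (simp add: append_rows_def)

lemma index_append_cols [simp]:
  "i < dim_row A \<Longrightarrow> j < dim_col A + dim_col B \<Longrightarrow>
     (A @\<^sub>c B) $$ (i, j) = (if j < dim_col A then A $$ (i, j) else B $$ (i, j - dim_col A))"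
  by (simp add: append_cols_def)

lemma row_append_rows:
  "i < dim_row A + dim_row B \<Longrightarrow> dim_col A = dim_col B \<Longrightarrow>
     row (A @\<^sub>r B) i = (if i < dim_row A then row A i else row B (i - dim_row A))"
  by (rule eq_vecI) auto

lemma col_append_cols:
  "j < dim_col A + dim_col B \<Longrightarrow> dim_row A = dim_row B \<Longrightarrow>
     col (A @\<^sub>c B) j = (if j < dim_col A then col A j else col B (j - dim_col A))"
  by (rule eq_vecI) auto

lemma append_rows_empty [simp]: "dim_row B = 0 \<Longrightarrow> A @\<^sub>r B = A"
  by (rule eq_matI) auto

lemma append_cols_empty [simp]: "dim_col B = 0 \<Longrightarrow> A @\<^sub>c B = A"
  by (rule eq_matI) auto

lemma append_rows_assoc: "dim_col A = dim_col B \<Longrightarrow> (A @\<^sub>r B) @\<^sub>r C = A @\<^sub>r (B @\<^sub>r C)"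
  by (rule eq_matI) auto

lemma append_cols_assoc: "dim_row A = dim_row B \<Longrightarrow> (A @\<^sub>c B) @\<^sub>c C = A @\<^sub>c (B @\<^sub>c C)"
  by (rule eq_matI) auto

text \<open>Read from left to right, this turns a block matrix given by its rows into one given by its columns.\<close>

lemma append_rows_append_cols:
  "dim_row A = dim_row B \<Longrightarrow> dim_row C = dim_row D \<Longrightarrow> dim_col A = dim_col C \<Longrightarrow> dim_col B = dim_col D \<Longrightarrow>
     (A @\<^sub>c B) @\<^sub>r (C @\<^sub>c D) = (A @\<^sub>r C) @\<^sub>c (B @\<^sub>r D)"
  by (rule eq_matI) auto

lemma four_block_append:
  "dim_row A = dim_row B \<Longrightarrow> dim_row C = dim_row D \<Longrightarrow> dim_col A = dim_col C \<Longrightarrow> dim_col B = dim_col D \<Longrightarrow>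
     four_block_mat A B C D = (A @\<^sub>c B) @\<^sub>r (C @\<^sub>c D)"
  by (rule eq_matI) auto

lemma append_rows_zero: "0\<^sub>m a c @\<^sub>r 0\<^sub>m b c = 0\<^sub>m (a + b) c"
  by (rule eq_matI) auto

lemma append_cols_zero: "0\<^sub>m a b @\<^sub>c 0\<^sub>m a c = 0\<^sub>m a (b + c)"
  by (rule eq_matI) auto

lemma append_rows_mult:
  fixes A :: "'a::semiring_0 mat"
  shows "dim_col A = dim_col B \<Longrightarrow> (A @\<^sub>r B) * C = A * C @\<^sub>r B * C"
  by (rule eq_matI) (auto simp: row_append_rows)

lemma mult_append_cols:
  fixes A :: "'a::semiring_0 mat"
  shows "dim_row A = dim_row B \<Longrightarrow> C * (A @\<^sub>c B) = C * A @\<^sub>c C * B"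
  by (rule eq_matI) (auto simp: col_append_cols)

lemma append_cols_mult_append_rows:
  fixes A :: "'a::semiring_0 mat"
  assumes [simp]: "dim_row A = dim_row B" "dim_col A = dim_row C" "dim_col B = dim_row D" "dim_col C = dim_col D"
  shows "(A @\<^sub>c B) * (C @\<^sub>r D) = A * C + B * D"
proof (rule eq_matI)
  fix i j assume "i < dim_row (A * C + B * D)" "j < dim_col (A * C + B * D)"
  then show "((A @\<^sub>c B) * (C @\<^sub>r D)) $$ (i, j) = (A * C + B * D) $$ (i, j)"
    by (simp add: scalar_prod_def sum.atLeastLessThan_concat[of 0 "dim_row C" "dim_row C + dim_row D", symmetric]
         sum.shift_bounds_nat_ivl[of _ 0 "dim_row C" "dim_row D", simplified add.commute[of _ "dim_row C"] add_0_right])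
qed auto

lemma add_append_rows:
  fixes A :: "'a::semiring_0 mat"
  shows "dim_row A = dim_row C \<Longrightarrow> dim_row B = dim_row D \<Longrightarrow> dim_col A = dim_col B \<Longrightarrow> dim_col C = dim_col D \<Longrightarrow> 
    dim_col A = dim_col C \<Longrightarrow>
    (A @\<^sub>r B) + (C @\<^sub>r D) = (A + C) @\<^sub>r (B + D)"
  by (rule eq_matI) auto

lemma add_append_cols:
  fixes A :: "'a::semiring_0 mat"
  shows "dim_col A = dim_col C \<Longrightarrow> dim_col B = dim_col D \<Longrightarrow> dim_row A = dim_row B \<Longrightarrow> dim_row C = dim_row D \<Longrightarrow>
    dim_row A = dim_row C \<Longrightarrow>
    (A @\<^sub>c B) + (C @\<^sub>c D) = (A + C) @\<^sub>c (B + D)"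
  by (rule eq_matI) auto

lemma add_zero_dim:
  fixes A :: "'a::monoid_add mat"
  shows "dim_row A = a \<Longrightarrow> dim_col A = b \<Longrightarrow> A + 0\<^sub>m a b = A"
    and "dim_row A = a \<Longrightarrow> dim_col A = b \<Longrightarrow> 0\<^sub>m a b + A = A"
  by (auto intro!: eq_matI)

lemma mult_zero_dim:
  fixes A :: "'a::semiring_0 mat"
  shows "dim_col A = b \<Longrightarrow> A * 0\<^sub>m b c = 0\<^sub>m (dim_row A) c"
    and "dim_row A = b \<Longrightarrow> 0\<^sub>m a b * A = 0\<^sub>m a (dim_col A)"
  by (auto intro!: eq_matI)

lemma mult_one_dim:
  fixes A :: "'a::semiring_1 mat"
  shows "dim_col A = b \<Longrightarrow> A * 1\<^sub>m b = A"
    and "dim_row A = b \<Longrightarrow> 1\<^sub>m b * A = A"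
  by (auto intro!: eq_matI)

lemma diag_block_mult_append_rows:
  fixes X :: "'a::comm_ring_1 mat"
  assumes "dim_col X = dim_row A" "dim_col Y = dim_row B" "dim_col A = dim_col B"
  shows "diag_block_mat [X, Y] * (A @\<^sub>r B) = X * A @\<^sub>r Y * B"
proof -
  have "diag_block_mat [X, Y] = (X @\<^sub>c 0\<^sub>m (dim_row X) (dim_col Y)) @\<^sub>r (0\<^sub>m (dim_row Y) (dim_col X) @\<^sub>c Y)"
    by (simp add: Let_def four_block_append)
  then show ?thesis
    using assms by (simp add: append_rows_mult append_cols_mult_append_rows mult_zero_dim add_zero_dim del: diag_block_mat.simps)
qed

lemma append_cols_mult_diag_block:
  fixes X :: "'a::comm_ring_1 mat"
  assumes "dim_col A = dim_row X" "dim_col B = dim_row Y" "dim_row A = dim_row B"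
  shows "(A @\<^sub>c B) * diag_block_mat [X, Y] = A * X @\<^sub>c B * Y"
proof -
  have "diag_block_mat [X, Y] = (X @\<^sub>r 0\<^sub>m (dim_row Y) (dim_col X)) @\<^sub>c (0\<^sub>m (dim_row X) (dim_col Y) @\<^sub>r Y)"
    by (simp add: Let_def four_block_append append_rows_append_cols)
  then show ?thesis
    using assms by (simp add: mult_append_cols append_cols_mult_append_rows mult_zero_dim add_zero_dim del: diag_block_mat.simps)
qed

lemma dim_diag_block_pair [simp]:
  "dim_row (diag_block_mat [X, Y]) = dim_row X + dim_row Y"
  "dim_col (diag_block_mat [X, Y]) = dim_col X + dim_col Y"
  by (simp_all add: dim_diag_block_mat)

lemma mult_assoc_dim:
  fixes A :: "'a::semiring_0 mat"
  shows "dim_col A = dim_row B \<Longrightarrow> dim_col B = dim_row C \<Longrightarrow> A * B * C = A * (B * C)"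
  by (rule assoc_mult_mat[of _ "dim_row A" "dim_row B" _ "dim_row C" _ "dim_col C"]) auto

lemma mult_add_dim:
  fixes A :: "'a::semiring_0 mat"
  shows "dim_col A = dim_row B \<Longrightarrow> dim_row B = dim_row C \<Longrightarrow> dim_col B = dim_col C \<Longrightarrow>
    A * (B + C) = A * B + A * C"
  by (rule mult_add_distrib_mat[of _ "dim_row A" "dim_row B" _ "dim_col B"]) auto

lemma add_mult_dim:
  fixes A :: "'a::semiring_0 mat"
  shows "dim_row A = dim_row B \<Longrightarrow> dim_col A = dim_col B \<Longrightarrow> dim_col A = dim_row C \<Longrightarrow>
    (A + B) * C = A * C + B * C"
  by (rule add_mult_distrib_mat[of _ "dim_row A" "dim_col A" _ _ "dim_col C"]) auto

lemma append_rows_mult_append_cols: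
  fixes A :: "'a::semiring_0 mat"
  assumes "dim_col A = dim_col B" "dim_row C = dim_row D" "dim_col A = dim_row C"
  shows "(A @\<^sub>r B) * (C @\<^sub>c D) = (A * C @\<^sub>c A * D) @\<^sub>r (B * C @\<^sub>c B * D)"
  using assms by (simp add: append_rows_mult mult_append_cols append_rows_append_cols)

lemma add_minus_cancel_dim:
  fixes A B :: "'a::ab_group_add mat"
  shows "dim_row A = dim_row B \<Longrightarrow> dim_col A = dim_col B \<Longrightarrow> A + (B - A) = B"
  by (rule eq_matI) auto

lemma mult_minus_dim:
  fixes A :: "'a::ring mat"
  shows "dim_col A = dim_row B \<Longrightarrow> dim_row B = dim_row C \<Longrightarrow> dim_col B = dim_col C \<Longrightarrow>
    A * (B - C) = A * B - A * C"
  by (rule mult_minus_distrib_mat[of _ "dim_row A" "dim_row B" _ "dim_col B"]) auto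

lemma transpose_append_rows: "dim_col A = dim_col B \<Longrightarrow> (A @\<^sub>r B)\<^sup>T = A\<^sup>T @\<^sub>c B\<^sup>T"
  by (rule eq_matI) auto

lemma transpose_append_cols: "dim_row A = dim_row B \<Longrightarrow> (A @\<^sub>c B)\<^sup>T = A\<^sup>T @\<^sub>r B\<^sup>T"
  by (rule eq_matI) auto

lemma transpose_mult_dim:
  fixes A :: "'a::comm_semiring_0 mat"
  shows "dim_col A = dim_row B \<Longrightarrow> (A * B)\<^sup>T = B\<^sup>T * A\<^sup>T"
  by (rule transpose_mult[of _ "dim_row A" "dim_row B" _ "dim_col B"]) auto

section \<open>Orthogonal matrices\<close>

definition orthogonal_matrix :: "nat \<Rightarrow> 'a::semiring_1 mat \<Rightarrow> bool" where
  "orthogonal_matrix n P \<longleftrightarrow> P \<in> carrier_mat n n \<and> P * P\<^sup>T = 1\<^sub>m n \<and> P\<^sup>T * P = 1\<^sub>m n"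

lemma orthogonal_matrixD:
  assumes "orthogonal_matrix n P"
  shows "dim_row P = n" "dim_col P = n" "P * P\<^sup>T = 1\<^sub>m n" "P\<^sup>T * P = 1\<^sub>m n"
  using assms by (auto simp: orthogonal_matrix_def)

lemma orthogonal_matrixI:
  fixes P :: "'a::field mat"
  assumes "dim_row P = n" "dim_col P = n" "P * P\<^sup>T = 1\<^sub>m n"
  shows "orthogonal_matrix n P"
proof -
  have "P \<in> carrier_mat n n" using assms by auto
  moreover have "P\<^sup>T * P = 1\<^sub>m n"
    by (rule mat_mult_left_right_inverse[OF calculation _ assms(3)]) (use assms in auto)
  ultimately show ?thesis using assms by (simp add: orthogonal_matrix_def)
qed

lemma orthogonal_transpose: "orthogonal_matrix n P \<Longrightarrow> orthogonal_matrix n P\<^sup>T"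
  by (auto simp: orthogonal_matrix_def)

lemma orthogonal_one: "orthogonal_matrix n (1\<^sub>m n)"
  by (auto simp: orthogonal_matrix_def)

lemma orthogonal_mult:
  fixes P :: "'a::field mat"
  assumes "orthogonal_matrix n P" "orthogonal_matrix n Q"
  shows "orthogonal_matrix n (P * Q)"
proof (rule orthogonal_matrixI)
  note P = orthogonal_matrixD[OF assms(1)] and Q = orthogonal_matrixD[OF assms(2)]
  have "P * Q * (P * Q)\<^sup>T = P * (Q * Q\<^sup>T) * P\<^sup>T"
    using P(1,2) Q(1,2) by (simp add: transpose_mult_dim mult_assoc_dim)
  then show "P * Q * (P * Q)\<^sup>T = 1\<^sub>m n"
    using P(1-3) by (simp add: Q(3) mult_one_dim)
qed (use assms in \<open>auto dest: orthogonal_matrixD\<close>)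

lemma orthogonal_diag_block:
  fixes P :: "'a::field mat"
  assumes "orthogonal_matrix m P" "orthogonal_matrix n Q"
  shows "orthogonal_matrix (m + n) (diag_block_mat [P, Q])"
proof (rule orthogonal_matrixI)
  note P = orthogonal_matrixD[OF assms(1)] and Q = orthogonal_matrixD[OF assms(2)]
  have "(diag_block_mat [P, Q])\<^sup>T = (P\<^sup>T @\<^sub>c 0\<^sub>m m n) @\<^sub>r (0\<^sub>m n m @\<^sub>c Q\<^sup>T)"
    using P(1,2) Q(1,2) by (simp add: Let_def four_block_append transpose_append_rows transpose_append_cols append_rows_append_cols)
  moreover have "1\<^sub>m (m + n) = (1\<^sub>m m @\<^sub>c 0\<^sub>m m n) @\<^sub>r (0\<^sub>m n m @\<^sub>c (1\<^sub>m n :: 'a mat))"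
    by (simp add: four_block_append[symmetric])
  ultimately show "diag_block_mat [P, Q] * (diag_block_mat [P, Q])\<^sup>T = 1\<^sub>m (m + n)"
    using P(1-3) Q(1-3)
    by (simp add: diag_block_mult_append_rows mult_append_cols mult_zero_dim del: diag_block_mat.simps)
qed (use assms in \<open>auto dest: orthogonal_matrixD simp: dim_diag_block_mat simp del: diag_block_mat.simps\<close>)

lemma orthogonal_cancel:
  assumes "orthogonal_matrix n P" "dim_row A = n"
  shows "P * (P\<^sup>T * A) = A" "P\<^sup>T * (P * A) = A"
proof -
  note P = orthogonal_matrixD[OF assms(1)]
  have "P * (P\<^sup>T * A) = (P * P\<^sup>T) * A" "P\<^sup>T * (P * A) = (P\<^sup>T * P) * A"
    using P(1,2) assms(2) by (simp_all add: mult_assoc_dim)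
  then show "P * (P\<^sup>T * A) = A" "P\<^sup>T * (P * A) = A"
    using P(3,4) assms(2) by (simp_all add: mult_one_dim)
qed

lemma orthogonal_cancel_right:
  assumes "orthogonal_matrix n P" "dim_col A = n"
  shows "A * P\<^sup>T * P = A"
proof -
  note P = orthogonal_matrixD[OF assms(1)]
  have "A * P\<^sup>T * P = A * (P\<^sup>T * P)"
    using P(1,2) assms(2) by (simp add: mult_assoc_dim)
  then show ?thesis
    using P(4) assms(2) by (simp add: mult_one_dim)
qed

lemma orthogonal_swaprows:
  assumes "k < n" "l < n"
  shows "orthogonal_matrix n (swaprows_mat n k l :: 'a::field mat)"
proof -
  have "(swaprows_mat n k l :: 'a mat)\<^sup>T = swaprows_mat n k l"
    using assms by (intro eq_matI) auto
  then show ?thesis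
    using swaprows_mat_inv[OF assms, where ?'a = 'a] by (simp add: orthogonal_matrix_def)
qed


section \<open>Splitting and the final block permutations\<close>

lemma split_rows_append:
  assumes "split_rows A r = (X, Y)" "r \<le> dim_row A"
  shows "dim_row X = r" "dim_row Y = dim_row A - r" "dim_col X = dim_col A" "dim_col Y = dim_col A"
    and "A = X @\<^sub>r Y"
  using assms by (auto simp: split_rows_def split_block_def Let_def intro!: eq_matI)

lemma split_cols_append:
  assumes "split_cols A c = (X, Y)" "c \<le> dim_col A"
  shows "dim_row X = dim_row A" "dim_row Y = dim_row A" "dim_col X = c" "dim_col Y = dim_col A - c"
    and "A = X @\<^sub>c Y"
  using assms by (auto simp: split_cols_def split_block_def Let_def intro!: eq_matI)

lemma split_block_append:
  assumes "split_block A r c = (A1, A2, A3, A4)" "r \<le> dim_row A" "c \<le> dim_col A"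
  shows "dim_row A1 = r" "dim_row A2 = r" "dim_row A3 = dim_row A - r" "dim_row A4 = dim_row A - r"
    and "dim_col A1 = c" "dim_col A3 = c" "dim_col A2 = dim_col A - c" "dim_col A4 = dim_col A - c"
    and "A = (A1 @\<^sub>c A2) @\<^sub>r (A3 @\<^sub>c A4)"
  using assms by (auto simp: split_block_def Let_def intro!: eq_matI)

text \<open>A block permutation is known by its action on block matrices. These two lemmas cut the identity
  matrix into blocks, so that the action also determines the permutation matrix itself.\<close>

lemma append_rows_decompose:
  assumes "dim_row A = a + b"
  obtains X Y where "A = X @\<^sub>r Y" "dim_row X = a" "dim_row Y = b" "dim_col X = dim_col A" "dim_col Y = dim_col A"
  using split_rows_append[of A a] assms by (metis diff_add_inverse le_add1 surj_pair)

lemma append_cols_decompose: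
  assumes "dim_col A = a + b"
  obtains X Y where "A = X @\<^sub>c Y" "dim_col X = a" "dim_col Y = b" "dim_row X = dim_row A" "dim_row Y = dim_row A"
  using split_cols_append[of A a] assms by (metis diff_add_inverse le_add1 surj_pair)

lemma dim_pluq_S [simp]:
  "dim_row (pluq_S a b k m) = a + (b + (k + m))" "dim_col (pluq_S a b k m) = a + (b + (k + m))"
  by (simp_all add: pluq_S_def block_mat_def)

lemma dim_pluq_T [simp]:
  "dim_row (pluq_T r1 r2 r3 r4 h n) = r1 + (r2 + (r3 + (r4 + (h + n))))"
  "dim_col (pluq_T r1 r2 r3 r4 h n) = r1 + (r2 + (r3 + (r4 + (h + n))))"
  by (simp_all add: pluq_T_def block_mat_def)

lemmas block_mult_simps = append_rows_mult mult_append_cols append_cols_mult_append_rows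
  add_append_rows add_append_cols mult_zero_dim mult_one_dim add_zero_dim

lemma pluq_S_mult:
  fixes A B C D :: "'a::field mat"
  assumes [simp]: "dim_row A = a" "dim_row B = b" "dim_row C = k" "dim_row D = m"
    "dim_col A = c" "dim_col B = c" "dim_col C = c" "dim_col D = c"
  shows "pluq_S a b k m * (A @\<^sub>r B @\<^sub>r C @\<^sub>r D) = A @\<^sub>r C @\<^sub>r B @\<^sub>r D"
  by (simp add: pluq_S_def block_mat_def block_mult_simps)

lemma mult_pluq_S:
  fixes A B C D :: "'a::field mat"
  assumes [simp]: "dim_col A = a" "dim_col B = k" "dim_col C = b" "dim_col D = m"
    "dim_row A = c" "dim_row B = c" "dim_row C = c" "dim_row D = c"
  shows "(A @\<^sub>c B @\<^sub>c C @\<^sub>c D) * pluq_S a b k m = A @\<^sub>c C @\<^sub>c B @\<^sub>c D"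
  by (simp add: pluq_S_def block_mat_def block_mult_simps)

lemma mult_pluq_T:
  fixes A1 :: "'a::field mat"
  assumes [simp]: "dim_col A1 = r1" "dim_col A2 = r2" "dim_col A3 = r3" "dim_col A4 = r4" "dim_col A5 = h" "dim_col A6 = n"
    "dim_row A1 = c" "dim_row A2 = c" "dim_row A3 = c" "dim_row A4 = c" "dim_row A5 = c" "dim_row A6 = c"
  shows "(A1 @\<^sub>c A2 @\<^sub>c A3 @\<^sub>c A4 @\<^sub>c A5 @\<^sub>c A6) * pluq_T r1 r2 r3 r4 h n
    = A1 @\<^sub>c A3 @\<^sub>c A5 @\<^sub>c A2 @\<^sub>c A4 @\<^sub>c A6"
  by (simp add: pluq_T_def block_mat_def block_mult_simps)

lemma pluq_T_mult:
  fixes A1 :: "'a::field mat"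
  assumes [simp]: "dim_row A1 = r1" "dim_row A2 = r2" "dim_row A3 = r3" "dim_row A4 = r4" "dim_row A5 = h" "dim_row A6 = n"
    "dim_col A1 = c" "dim_col A2 = c" "dim_col A3 = c" "dim_col A4 = c" "dim_col A5 = c" "dim_col A6 = c"
  shows "pluq_T r1 r2 r3 r4 h n * (A1 @\<^sub>r A3 @\<^sub>r A5 @\<^sub>r A2 @\<^sub>r A4 @\<^sub>r A6)
    = A1 @\<^sub>r A2 @\<^sub>r A3 @\<^sub>r A4 @\<^sub>r A5 @\<^sub>r A6"
  by (simp add: pluq_T_def block_mat_def block_mult_simps)

text \<open>\<open>S\<close> permutes row strips one way and column strips the inverse way. Applied to the strips of the
  identity matrix, this gives \<open>S\<^sup>T S = 1\<close>.\<close>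

lemma orthogonal_pluq_S: "orthogonal_matrix (a + (b + (k + m))) (pluq_S a b k m :: 'a::field mat)"
proof -
  let ?S = "pluq_S a b k m :: 'a mat" and ?n = "a + (b + (k + m))"
  obtain A X where X: "(1\<^sub>m ?n :: 'a mat) = A @\<^sub>r X" "dim_row A = a" "dim_row X = b + (k + m)" "dim_col A = ?n" "dim_col X = ?n"
    by (rule append_rows_decompose[of "1\<^sub>m ?n :: 'a mat" a "b + (k + m)"]) (simp, metis index_one_mat(3))
  obtain B Y where Y: "X = B @\<^sub>r Y" "dim_row B = b" "dim_row Y = k + m" "dim_col B = ?n" "dim_col Y = ?n"
    using X by (metis append_rows_decompose)
  obtain C D where Z: "Y = C @\<^sub>r D" "dim_row C = k" "dim_row D = m" "dim_col C = ?n" "dim_col D = ?n"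
    using Y by (metis append_rows_decompose)
  note dims = X(2,4) Y(2,4) Z(2-5)
  have id: "1\<^sub>m ?n = A @\<^sub>r B @\<^sub>r C @\<^sub>r D" using X(1) Y(1) Z(1) by simp
  have "(A @\<^sub>r C @\<^sub>r B @\<^sub>r D)\<^sup>T * ?S = (A @\<^sub>r B @\<^sub>r C @\<^sub>r D)\<^sup>T"
    using dims by (simp add: transpose_append_rows mult_pluq_S[where c = ?n])
  then have "?S\<^sup>T * (A @\<^sub>r C @\<^sub>r B @\<^sub>r D) = 1\<^sub>m ?n"
    unfolding id[symmetric] using dims
    by (metis dim_append_rows(1) dim_pluq_S(1) index_transpose_mat(3) transpose_mult_dim transpose_one transpose_transpose add.left_commute)
  moreover have "?S * 1\<^sub>m ?n = A @\<^sub>r C @\<^sub>r B @\<^sub>r D"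
    unfolding id by (rule pluq_S_mult) (use dims in simp_all)
  ultimately have "?S\<^sup>T * ?S\<^sup>T\<^sup>T = 1\<^sub>m ?n" by (simp add: mult_one_dim)
  then have "orthogonal_matrix ?n ?S\<^sup>T" by (intro orthogonal_matrixI) auto
  then show ?thesis using orthogonal_transpose by fastforce
qed

lemma orthogonal_pluq_T:
  "orthogonal_matrix (r1 + (r2 + (r3 + (r4 + (h + n))))) (pluq_T r1 r2 r3 r4 h n :: 'a::field mat)"
proof -
  let ?T = "pluq_T r1 r2 r3 r4 h n :: 'a mat" and ?n = "r1 + (r2 + (r3 + (r4 + (h + n))))"
  obtain A1 X1 where 1: "(1\<^sub>m ?n :: 'a mat) = A1 @\<^sub>c X1" "dim_col A1 = r1" "dim_col X1 = r2 + (r3 + (r4 + (h + n)))"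
      "dim_row A1 = ?n" "dim_row X1 = ?n"
    by (rule append_cols_decompose[of "1\<^sub>m ?n :: 'a mat" r1 "r2 + (r3 + (r4 + (h + n)))"]) (simp, metis index_one_mat(2))
  obtain A2 X2 where 2: "X1 = A2 @\<^sub>c X2" "dim_col A2 = r2" "dim_col X2 = r3 + (r4 + (h + n))" "dim_row A2 = ?n" "dim_row X2 = ?n"
    using 1 by (metis append_cols_decompose)
  obtain A3 X3 where 3: "X2 = A3 @\<^sub>c X3" "dim_col A3 = r3" "dim_col X3 = r4 + (h + n)" "dim_row A3 = ?n" "dim_row X3 = ?n"
    using 2 by (metis append_cols_decompose)
  obtain A4 X4 where 4: "X3 = A4 @\<^sub>c X4" "dim_col A4 = r4" "dim_col X4 = h + n" "dim_row A4 = ?n" "dim_row X4 = ?n"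
    using 3 by (metis append_cols_decompose)
  obtain A5 A6 where 5: "X4 = A5 @\<^sub>c A6" "dim_col A5 = h" "dim_col A6 = n" "dim_row A5 = ?n" "dim_row A6 = ?n"
    using 4 by (metis append_cols_decompose)
  note dims = 1(2,4) 2(2,4) 3(2,4) 4(2,4) 5(2-5)
  let ?A = "A1 @\<^sub>c A2 @\<^sub>c A3 @\<^sub>c A4 @\<^sub>c A5 @\<^sub>c A6" and ?B = "A1 @\<^sub>c A3 @\<^sub>c A5 @\<^sub>c A2 @\<^sub>c A4 @\<^sub>c A6"
  have id: "1\<^sub>m ?n = ?A" using 1(1) 2(1) 3(1) 4(1) 5(1) by simp
  have "1\<^sub>m ?n * ?T = ?B" unfolding id by (rule mult_pluq_T) (use dims in simp_all)
  then have TB: "?T = ?B" by (simp add: mult_one_dim)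
  have "?T * ?B\<^sup>T = ?A\<^sup>T"
    using dims by (simp add: transpose_append_cols pluq_T_mult[where c = ?n])
  then have "?T * ?T\<^sup>T = 1\<^sub>m ?n" unfolding TB[symmetric] id[symmetric] by simp
  then show ?thesis by (intro orthogonal_matrixI) auto
qed

text \<open>\<open>S\<close> reorders the six row strips of \<open>[L; M]\<close>, pivot strips first, into the order of the rows of
  \<open>A\<close>. After that, \<open>P\<^sub>1, P\<^sub>2\<close> act on the upper half and \<open>P\<^sub>3, P\<^sub>4\<close> on the lower half only.\<close>

lemma pluq_left_factor:
  fixes P1 P2 P3 P4 :: "'a::field mat"
  assumes [simp]: "dim_row P1 = r1 + (r2 + k)" "dim_col P1 = r1 + (r2 + k)" "dim_row P2 = r2 + k" "dim_col P2 = r2 + k"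
    "dim_row P3 = r3 + (r4 + m)" "dim_col P3 = r3 + (r4 + m)" "dim_row P4 = r4 + m" "dim_col P4 = r4 + m"
    and [simp]: "dim_row R1 = r1" "dim_row R2 = r2" "dim_row R3 = r3" "dim_row R4 = r4" "dim_row R5 = k" "dim_row R6 = m"
    and [simp]: "dim_col R1 = c" "dim_col R2 = c" "dim_col R3 = c" "dim_col R4 = c" "dim_col R5 = c" "dim_col R6 = c"
  shows "diag_block_mat [P1 * diag_block_mat [1\<^sub>m r1, P2], P3 * diag_block_mat [1\<^sub>m r3, P4]]
           * pluq_S (r1 + r2) (r3 + r4) k m * ((R1 @\<^sub>r R2 @\<^sub>r R3 @\<^sub>r R4) @\<^sub>r (R5 @\<^sub>r R6))
         = P1 * (R1 @\<^sub>r P2 * (R2 @\<^sub>r R5)) @\<^sub>r P3 * (R3 @\<^sub>r P4 * (R4 @\<^sub>r R6))"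
proof -
  let ?D1 = "P1 * diag_block_mat [1\<^sub>m r1, P2]" and ?D3 = "P3 * diag_block_mat [1\<^sub>m r3, P4]"
  let ?S = "pluq_S (r1 + r2) (r3 + r4) k m" and ?R = "(R1 @\<^sub>r R2 @\<^sub>r R3 @\<^sub>r R4) @\<^sub>r (R5 @\<^sub>r R6)"
  have "?S * ?R = (R1 @\<^sub>r (R2 @\<^sub>r R5)) @\<^sub>r (R3 @\<^sub>r (R4 @\<^sub>r R6))"
    using pluq_S_mult[of "R1 @\<^sub>r R2" "r1 + r2" "R3 @\<^sub>r R4" "r3 + r4" R5 k R6 m c] by (simp add: append_rows_assoc)
  moreover have "diag_block_mat [?D1, ?D3] * ?S * ?R = diag_block_mat [?D1, ?D3] * (?S * ?R)"
    by (rule mult_assoc_dim) (simp_all del: diag_block_mat.simps)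
  ultimately show ?thesis
    by (simp add: diag_block_mult_append_rows mult_assoc_dim mult_one_dim del: diag_block_mat.simps)
qed

text \<open>The counterpart for columns: \<open>T\<close> puts the column strips of \<open>[U V]\<close> into the order of the columns
  of \<open>A\<close>.\<close>

lemma pluq_right_factor:
  fixes Q1 Q2 Q3 Q4 :: "'a::field mat"
  assumes [simp]: "dim_row Q1 = r1 + (r3 + h)" "dim_col Q1 = r1 + (r3 + h)" "dim_row Q3 = r3 + h" "dim_col Q3 = r3 + h"
    "dim_row Q2 = r2 + (r4 + n)" "dim_col Q2 = r2 + (r4 + n)" "dim_row Q4 = r4 + n" "dim_col Q4 = r4 + n"
    and [simp]: "dim_col C1 = r1" "dim_col C2 = r2" "dim_col C3 = r3" "dim_col C4 = r4" "dim_col C5 = h" "dim_col C6 = n"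
    and [simp]: "dim_row C1 = c" "dim_row C2 = c" "dim_row C3 = c" "dim_row C4 = c" "dim_row C5 = c" "dim_row C6 = c"
  shows "((C1 @\<^sub>c C2 @\<^sub>c C3 @\<^sub>c C4) @\<^sub>c (C5 @\<^sub>c C6)) * (pluq_T r1 r2 r3 r4 h n
           * diag_block_mat [diag_block_mat [1\<^sub>m r1, Q3] * Q1, diag_block_mat [1\<^sub>m r2, Q4] * Q2])
         = (C1 @\<^sub>c (C3 @\<^sub>c C5) * Q3) * Q1 @\<^sub>c (C2 @\<^sub>c (C4 @\<^sub>c C6) * Q4) * Q2"
proof -
  let ?D1 = "diag_block_mat [1\<^sub>m r1, Q3] * Q1" and ?D2 = "diag_block_mat [1\<^sub>m r2, Q4] * Q2"
  let ?T = "pluq_T r1 r2 r3 r4 h n" and ?C = "(C1 @\<^sub>c C2 @\<^sub>c C3 @\<^sub>c C4) @\<^sub>c (C5 @\<^sub>c C6)"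
  have "?C * (?T * diag_block_mat [?D1, ?D2]) = ?C * ?T * diag_block_mat [?D1, ?D2]"
    by (rule mult_assoc_dim[symmetric]) (simp_all del: diag_block_mat.simps)
  also have "?C * ?T = (C1 @\<^sub>c C3 @\<^sub>c C5) @\<^sub>c (C2 @\<^sub>c C4 @\<^sub>c C6)"
    using mult_pluq_T[of C1 r1 C2 r2 C3 r3 C4 r4 C5 h C6 n c] by (simp add: append_cols_assoc)
  also have "\<dots> * diag_block_mat [?D1, ?D2] = (C1 @\<^sub>c C3 @\<^sub>c C5) * ?D1 @\<^sub>c (C2 @\<^sub>c C4 @\<^sub>c C6) * ?D2"
    by (rule append_cols_mult_diag_block) (simp_all del: diag_block_mat.simps)
  finally show ?thesis
    by (simp add: append_cols_mult_diag_block mult_assoc_dim[symmetric] mult_one_dim del: diag_block_mat.simps)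
qed


section \<open>Padded multiplication and triangular solving\<close>

lemma fst_bind_counted [simp]: "fst (bind_counted x f) = fst (f (fst x))"
  by (simp add: bind_counted_def split_beta)

lemma snd_bind_counted [simp]: "snd (bind_counted x f) = snd x + snd (f (fst x))"
  by (simp add: bind_counted_def split_beta)

lemma counted_simps [simp]: "fst (ret x) = x" "snd (ret x) = 0" "fst (spend k) = ()" "snd (spend k) = k"
  by (simp_all add: ret_def spend_def)

lemma slp_mat_simps [simp]:
  "snd (slp_mat p a b A B) = slp_ops p"
  "dim_row (fst (slp_mat p a b A B)) = a" "dim_col (fst (slp_mat p a b A B)) = b"
  by (simp_all add: slp_mat_def Let_def)

lemma dim_resize [simp]: "dim_row (resize a b A) = a" "dim_col (resize a b A) = b"
  by (simp_all add: resize_def)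

text \<open>Zero padding does not change the entries that are kept, since the inner dimension is not padded.\<close>

lemma fst_mul_counted:
  assumes "mm_routine \<omega> mm" "dim_col A = dim_row B"
  shows "fst (mul_counted (mm, lsolve, usolve) A B) = A * B"
proof -
  define s a b where "s = dim_col A" and "a = max s (dim_row A)" and "b = max s (dim_col B)"
  have "s \<le> min a b" by (simp add: a_def b_def)
  then have "\<forall>A \<in> carrier_mat a s. \<forall>B \<in> carrier_mat s b. fst (slp_mat (mm a s b) a b A B) = A * B"
    using assms(1) unfolding mm_routine_def by blast
  then have "fst (slp_mat (mm a s b) a b (resize a s A) (resize s b B)) = resize a s A * resize s b B"
    by (metis carrier_matI dim_resize)
  then have "fst (mul_counted (mm, lsolve, usolve) A B)
      = resize (dim_row A) (dim_col B) (resize a s A * resize s b B)"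
    by (simp add: Let_def s_def[symmetric] a_def[symmetric] b_def[symmetric])
  also have "\<dots> = A * B"
    using assms(2) by (intro eq_matI) (auto simp: resize_def scalar_prod_def s_def a_def b_def)
  finally show ?thesis .
qed

lemma fst_sub_mul_counted:
  fixes A B C :: "'a::field mat"
  assumes "mm_routine \<omega> mm" "dim_col A = dim_row B" "dim_row C = dim_row A" "dim_col C = dim_col B"
  shows "fst (sub_mul_counted (mm, lsolve, usolve) C A B) = C - A * B"
proof (cases "dim_col A = 0")
  case True
  then have "C - A * B = C"
    using assms(2-4) by (intro eq_matI) (auto simp: scalar_prod_def)
  then show ?thesis using True by (simp add: sub_mul_counted_def)
next
  case False
  then show ?thesis
    using assms by (simp add: sub_mul_counted_def fst_mul_counted del: mul_counted.simps)
qed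

text \<open>The padding adds right-hand sides, and each column of the solution depends on its own right-hand
  side only.\<close>

lemma fst_lsolve_counted:
  fixes mm :: "nat \<Rightarrow> nat \<Rightarrow> nat \<Rightarrow> 'a::field slp" and lsolve usolve :: "nat \<Rightarrow> nat \<Rightarrow> 'a slp"
  assumes "lower_solve_routine \<omega> lsolve" "unit_lower_triangular L" "dim_row L = s" "dim_col L = s" "dim_row B = s"
  defines "X \<equiv> fst (lsolve_counted (mm, lsolve, usolve) L B)"
  shows "dim_row X = s" "dim_col X = dim_col B" "L * X = B"
proof -
  define b where "b = max s (dim_col B)"
  define Y where "Y = fst (slp_mat (lsolve s b) s b L (resize s b B))"
  have "\<forall>L \<in> carrier_mat s s. \<forall>B \<in> carrier_mat s b. unit_lower_triangular L \<longrightarrow>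
      L * fst (slp_mat (lsolve s b) s b L B) = B"
    using assms(1) max.cobounded1 unfolding lower_solve_routine_def b_def by blast
  then have LY: "L * Y = resize s b B"
    unfolding Y_def using assms(2-4) by (metis carrier_matI dim_resize)
  have X: "X = resize s (dim_col B) Y"
    using assms(3) by (simp add: X_def Let_def Y_def b_def)
  show "dim_row X = s" "dim_col X = dim_col B" by (simp_all add: X)
  show "L * X = B"
  proof (rule eq_matI)
    fix i j assume ij: "i < dim_row B" "j < dim_col B"
    then have "col X j = col Y j"
      by (intro eq_vecI) (auto simp: X resize_def Y_def b_def)
    then have "(L * X) $$ (i, j) = (L * Y) $$ (i, j)"
      using ij assms(3,5) by (simp add: X Y_def b_def)
    then show "(L * X) $$ (i, j) = B $$ (i, j)"
      using ij assms(5) by (simp add: LY resize_def b_def)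
  qed (simp_all add: X assms(3,5))
qed

lemma fst_usolve_counted:
  fixes mm :: "nat \<Rightarrow> nat \<Rightarrow> nat \<Rightarrow> 'a::field slp" and lsolve usolve :: "nat \<Rightarrow> nat \<Rightarrow> 'a slp"
  assumes "upper_solve_routine \<omega> usolve" "upper_triangular U" "\<forall>i < s. U $$ (i, i) \<noteq> 0"
    and "dim_row U = s" "dim_col U = s" "dim_col C = s"
  defines "X \<equiv> fst (usolve_counted (mm, lsolve, usolve) C U)"
  shows "dim_row X = dim_row C" "dim_col X = s" "X * U = C"
proof -
  define b where "b = max s (dim_row C)"
  define Y where "Y = fst (slp_mat (usolve s b) b s (resize b s C) U)"
  have "\<forall>C \<in> carrier_mat b s. \<forall>U \<in> carrier_mat s s.
      upper_triangular U \<and> (\<forall>i < s. U $$ (i, i) \<noteq> 0) \<longrightarrow> fst (slp_mat (usolve s b) b s C U) * U = C"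
    using assms(1) max.cobounded1 unfolding upper_solve_routine_def b_def by blast
  then have YU: "Y * U = resize b s C"
    unfolding Y_def using assms(2-5) by (metis carrier_matI dim_resize)
  have X: "X = resize (dim_row C) s Y"
    using assms(4) by (simp add: X_def Let_def Y_def b_def)
  show "dim_row X = dim_row C" "dim_col X = s" by (simp_all add: X)
  show "X * U = C"
  proof (rule eq_matI)
    fix i j assume ij: "i < dim_row C" "j < dim_col C"
    then have "row X i = row Y i"
      by (intro eq_vecI) (auto simp: X resize_def Y_def b_def)
    then have "(X * U) $$ (i, j) = (Y * U) $$ (i, j)"
      using ij assms(5,6) by (simp add: X Y_def b_def)
    then show "(X * U) $$ (i, j) = C $$ (i, j)"
      using ij assms(6) by (simp add: YU resize_def b_def)
  qed (simp_all add: X assms(5,6))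
qed

section \<open>Triangular blocks\<close>

definition nonsingular_upper :: "'a::zero mat \<Rightarrow> bool" where
  "nonsingular_upper U \<longleftrightarrow> upper_triangular U \<and> (\<forall>i < dim_row U. U $$ (i, i) \<noteq> 0)"

lemma unit_lower_triangular_append:
  assumes "unit_lower_triangular A" "unit_lower_triangular D" "Z = 0\<^sub>m a d"
    and "dim_row A = a" "dim_col A = a" "dim_row D = d" "dim_col D = d" "dim_row C = d" "dim_col C = a"
  shows "unit_lower_triangular ((A @\<^sub>c Z) @\<^sub>r (C @\<^sub>c D))"
  using assms by (auto simp: unit_lower_triangular_def upper_triangular_def)

lemma nonsingular_upper_append:
  assumes "nonsingular_upper A" "nonsingular_upper D" "Z = 0\<^sub>m d a"
    and "dim_row A = a" "dim_col A = a" "dim_row D = d" "dim_col D = d" "dim_row B = a" "dim_col B = d"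
  shows "nonsingular_upper ((A @\<^sub>c B) @\<^sub>r (Z @\<^sub>c D))"
  using assms by (auto simp: nonsingular_upper_def upper_triangular_def)

text \<open>The four by four block matrix is a two by two block triangular matrix in three nested ways, so
  the two by two case suffices.\<close>

lemma unit_lower_triangular_block:
  fixes L1 :: "'a::field mat"
  assumes [simp]: "dim_row L1 = r1" "dim_col L1 = r1" "dim_row L2 = r2" "dim_col L2 = r2"
    "dim_row L3 = r3" "dim_col L3 = r3" "dim_row L4 = r4" "dim_col L4 = r4"
    "dim_row L21 = r2" "dim_col L21 = r1" "dim_row L31 = r3" "dim_col L31 = r1" "dim_row L41 = r4" "dim_col L41 = r1"
    "dim_row L32 = r3" "dim_col L32 = r2" "dim_row L42 = r4" "dim_col L42 = r2" "dim_row L43 = r4" "dim_col L43 = r3"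
    and tri: "unit_lower_triangular L1" "unit_lower_triangular L2" "unit_lower_triangular L3" "unit_lower_triangular L4"
  shows "unit_lower_triangular (block_mat
    [[L1, 0\<^sub>m r1 r2, 0\<^sub>m r1 r3, 0\<^sub>m r1 r4], [L21, L2, 0\<^sub>m r2 r3, 0\<^sub>m r2 r4], [L31, L32, L3, 0\<^sub>m r3 r4], [L41, L42, L43, L4]])"
    (is "unit_lower_triangular ?L")
proof -
  let ?L34 = "(L3 @\<^sub>c 0\<^sub>m r3 r4) @\<^sub>r (L43 @\<^sub>c L4)"
  let ?L24 = "(L2 @\<^sub>c (0\<^sub>m r2 r3 @\<^sub>c 0\<^sub>m r2 r4)) @\<^sub>r ((L32 @\<^sub>r L42) @\<^sub>c ?L34)"
  have "?L = (L1 @\<^sub>c (0\<^sub>m r1 r2 @\<^sub>c 0\<^sub>m r1 r3 @\<^sub>c 0\<^sub>m r1 r4)) @\<^sub>r ((L21 @\<^sub>r L31 @\<^sub>r L41) @\<^sub>c ?L24)"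
    by (simp add: block_mat_def append_rows_append_cols)
  moreover have "unit_lower_triangular ?L34"
    by (rule unit_lower_triangular_append[OF tri(3,4) refl]) simp_all
  then have "unit_lower_triangular ?L24"
    by (rule unit_lower_triangular_append[OF tri(2), where d = "r3 + r4"]) (simp_all add: append_cols_zero)
  then have "unit_lower_triangular ((L1 @\<^sub>c (0\<^sub>m r1 r2 @\<^sub>c 0\<^sub>m r1 r3 @\<^sub>c 0\<^sub>m r1 r4)) @\<^sub>r ((L21 @\<^sub>r L31 @\<^sub>r L41) @\<^sub>c ?L24))"
    by (rule unit_lower_triangular_append[OF tri(1), where d = "r2 + (r3 + r4)"]) (simp_all add: append_cols_zero)
  ultimately show ?thesis by simp
qed

lemma nonsingular_upper_block:
  fixes U1 :: "'a::field mat"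
  assumes [simp]: "dim_row U1 = r1" "dim_col U1 = r1" "dim_row U2 = r2" "dim_col U2 = r2"
    "dim_row U3 = r3" "dim_col U3 = r3" "dim_row U4 = r4" "dim_col U4 = r4"
    "dim_row U12 = r1" "dim_col U12 = r2" "dim_row U13 = r1" "dim_col U13 = r3" "dim_row U14 = r1" "dim_col U14 = r4"
    "dim_row U24 = r2" "dim_col U24 = r4" "dim_row U34 = r3" "dim_col U34 = r4"
    and tri: "nonsingular_upper U1" "nonsingular_upper U2" "nonsingular_upper U3" "nonsingular_upper U4"
  shows "nonsingular_upper (block_mat
    [[U1, U12, U13, U14], [0\<^sub>m r2 r1, U2, 0\<^sub>m r2 r3, U24], [0\<^sub>m r3 r1, 0\<^sub>m r3 r2, U3, U34], [0\<^sub>m r4 r1, 0\<^sub>m r4 r2, 0\<^sub>m r4 r3, U4]])"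
    (is "nonsingular_upper ?U")
proof -
  let ?U34 = "(U3 @\<^sub>c U34) @\<^sub>r (0\<^sub>m r4 r3 @\<^sub>c U4)"
  let ?U24 = "(U2 @\<^sub>c (0\<^sub>m r2 r3 @\<^sub>c U24)) @\<^sub>r ((0\<^sub>m r3 r2 @\<^sub>r 0\<^sub>m r4 r2) @\<^sub>c ?U34)"
  have "?U = (U1 @\<^sub>c (U12 @\<^sub>c U13 @\<^sub>c U14)) @\<^sub>r ((0\<^sub>m r2 r1 @\<^sub>r 0\<^sub>m r3 r1 @\<^sub>r 0\<^sub>m r4 r1) @\<^sub>c ?U24)"
    by (simp add: block_mat_def append_rows_append_cols)
  moreover have "nonsingular_upper ?U34"
    by (rule nonsingular_upper_append[OF tri(3,4) refl]) simp_all
  then have "nonsingular_upper ?U24"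
    by (rule nonsingular_upper_append[OF tri(2), where d = "r3 + r4"]) (simp_all add: append_rows_zero)
  then have "nonsingular_upper ((U1 @\<^sub>c (U12 @\<^sub>c U13 @\<^sub>c U14)) @\<^sub>r ((0\<^sub>m r2 r1 @\<^sub>r 0\<^sub>m r3 r1 @\<^sub>r 0\<^sub>m r4 r1) @\<^sub>c ?U24))"
    by (rule nonsingular_upper_append[OF tri(1), where d = "r2 + (r3 + r4)"]) (simp_all add: append_rows_zero)
  ultimately show ?thesis by simp
qed

section \<open>Assembling the factorization\<close>

text \<open>The block identity behind the algorithm. Undoing the permutations turns \<open>P [L; M]\<close> into
  \<open>[P\<^sub>1 RT; P\<^sub>3 RB]\<close> and \<open>[U V] Q\<close> into \<open>[CL Q\<^sub>1, CR Q\<^sub>2]\<close>, where the strips that had been permuted by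
  \<open>P\<^sub>2, Q\<^sub>3, P\<^sub>4, Q\<^sub>4\<close> are whole again (they are \<open>M\<^sub>1, V\<^sub>1\<close> and so on). The four products are the
  quadrants of \<open>A\<close>: the equations that define \<open>D, E, X, K, O\<close> are exactly those that make them agree,
  and \<open>F, G, W\<close> are what is left after elimination. The premises state these equations with the
  eliminated part moved to the other side, which avoids subtraction.\<close>

lemma pluq_assemble:
  fixes A1 :: "'a::field mat"
  assumes [simp]: "dim_row P1 = r1 + (r2 + k)" "dim_col P1 = r1 + (r2 + k)" "dim_row P2 = r2 + k" "dim_col P2 = r2 + k"
    "dim_row P3 = r3 + (r4 + m)" "dim_col P3 = r3 + (r4 + m)" "dim_row P4 = r4 + m" "dim_col P4 = r4 + m"
    "dim_row Q1 = r1 + (r3 + h)" "dim_col Q1 = r1 + (r3 + h)" "dim_row Q3 = r3 + h" "dim_col Q3 = r3 + h"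
    "dim_row Q2 = r2 + (r4 + n)" "dim_col Q2 = r2 + (r4 + n)" "dim_row Q4 = r4 + n" "dim_col Q4 = r4 + n"
    and [simp]: "dim_row L1 = r1" "dim_col L1 = r1" "dim_row M1 = r2 + k" "dim_col M1 = r1"
    "dim_row U1 = r1" "dim_col U1 = r1" "dim_row V1 = r1" "dim_col V1 = r3 + h"
    "dim_row L2 = r2" "dim_col L2 = r2" "dim_row M2 = k" "dim_col M2 = r2"
    "dim_row U2 = r2" "dim_col U2 = r2" "dim_row V2 = r2" "dim_col V2 = r4 + n"
    "dim_row L3 = r3" "dim_col L3 = r3" "dim_row M3 = r4 + m" "dim_col M3 = r3"
    "dim_row U3 = r3" "dim_col U3 = r3" "dim_row V3 = r3" "dim_col V3 = h"
    "dim_row L4 = r4" "dim_col L4 = r4" "dim_row M4 = m" "dim_col M4 = r4"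
    "dim_row U4 = r4" "dim_col U4 = r4" "dim_row V4 = r4" "dim_col V4 = n"
    and [simp]: "dim_row D = r1" "dim_col D = r2 + (r4 + n)" "dim_row E = r3 + (r4 + m)" "dim_col E = r1"
    "dim_row X = r3" "dim_col X = r2" "dim_row K = r4 + m" "dim_col K = r2" "dim_row O' = r3" "dim_col O' = r4 + n"
    "dim_row E1 = r3" "dim_col E1 = r1" "dim_row E2 = r4 + m" "dim_col E2 = r1"
    "dim_row M11 = r2" "dim_col M11 = r1" "dim_row M12 = k" "dim_col M12 = r1"
    "dim_row D1 = r1" "dim_col D1 = r2" "dim_row D2 = r1" "dim_col D2 = r4 + n"
    "dim_row V11 = r1" "dim_col V11 = r3" "dim_row V12 = r1" "dim_col V12 = h"
    "dim_row E21 = r4" "dim_col E21 = r1" "dim_row E22 = m" "dim_col E22 = r1"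
    "dim_row M31 = r4" "dim_col M31 = r3" "dim_row M32 = m" "dim_col M32 = r3"
    "dim_row K1 = r4" "dim_col K1 = r2" "dim_row K2 = m" "dim_col K2 = r2"
    "dim_row D21 = r1" "dim_col D21 = r4" "dim_row D22 = r1" "dim_col D22 = n"
    "dim_row V21 = r2" "dim_col V21 = r4" "dim_row V22 = r2" "dim_col V22 = n"
    "dim_row O1 = r3" "dim_col O1 = r4" "dim_row O2 = r3" "dim_col O2 = n"
    and A1: "A1 = P1 * ((L1 @\<^sub>r M1) * (U1 @\<^sub>c V1)) * Q1"
    and A2: "A2 = P1 * (L1 * D @\<^sub>r (M1 * D + F))"
    and A3: "A3 = (E * U1 @\<^sub>c (E * V1 + G)) * Q1"
    and A4: "A4 = E * D + H"
    and F: "F = P2 * ((L2 @\<^sub>r M2) * (U2 @\<^sub>c V2)) * Q2"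
    and G: "G = P3 * ((L3 @\<^sub>r M3) * (U3 @\<^sub>c V3)) * Q3"
    and H: "H = P3 * ((X * U2 @\<^sub>c (X * V2 + L3 * O')) @\<^sub>r (K * U2 @\<^sub>c (K * V2 + (M3 * O' + W)))) * Q2"
    and W: "W = P4 * ((L4 @\<^sub>r M4) * (U4 @\<^sub>c V4)) * Q4"
    and E: "E = P3 * (E1 @\<^sub>r E2)" and M1: "M1 = P2 * (M11 @\<^sub>r M12)"
    and D: "D = (D1 @\<^sub>c D2) * Q2" and V1: "V1 = (V11 @\<^sub>c V12) * Q3"
    and E2: "E2 = P4 * (E21 @\<^sub>r E22)" and M3: "M3 = P4 * (M31 @\<^sub>r M32)" and K: "K = P4 * (K1 @\<^sub>r K2)"
    and D2: "D2 = (D21 @\<^sub>c D22) * Q4" and V2: "V2 = (V21 @\<^sub>c V22) * Q4" and O': "O' = (O1 @\<^sub>c O2) * Q4"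
    and P_def: "P = diag_block_mat [P1 * diag_block_mat [1\<^sub>m r1, P2], P3 * diag_block_mat [1\<^sub>m r3, P4]]
           * pluq_S (r1 + r2) (r3 + r4) k m"
    and Q_def: "Q = pluq_T r1 r2 r3 r4 h n
           * diag_block_mat [diag_block_mat [1\<^sub>m r1, Q3] * Q1, diag_block_mat [1\<^sub>m r2, Q4] * Q2]"
    and L_def: "L = block_mat
           [[L1, 0\<^sub>m r1 r2, 0\<^sub>m r1 r3, 0\<^sub>m r1 r4],
            [M11, L2, 0\<^sub>m r2 r3, 0\<^sub>m r2 r4],
            [E1, X, L3, 0\<^sub>m r3 r4],
            [E21, K1, M31, L4]]"
    and M_def: "M = block_mat
           [[M12, M2, 0\<^sub>m k r3, 0\<^sub>m k r4],
            [E22, K2, M32, M4]]"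
    and U_def: "U = block_mat
           [[U1, D1, V11, D21],
            [0\<^sub>m r2 r1, U2, 0\<^sub>m r2 r3, V21],
            [0\<^sub>m r3 r1, 0\<^sub>m r3 r2, U3, O1],
            [0\<^sub>m r4 r1, 0\<^sub>m r4 r2, 0\<^sub>m r4 r3, U4]]"
    and V_def: "V = block_mat
           [[V12, D22],
            [0\<^sub>m r2 h, V22],
            [V3, O2],
            [0\<^sub>m r4 h, V4]]"
  shows "P * ((L @\<^sub>r M) * (U @\<^sub>c V)) * Q = (A1 @\<^sub>c A2) @\<^sub>r (A3 @\<^sub>c A4)"
proof -
  define F1 W1 G2 W2 where "F1 = P2 * (L2 @\<^sub>r M2)" and "W1 = P4 * (L4 @\<^sub>r M4)"
    and "G2 = (U3 @\<^sub>c V3) * Q3" and "W2 = (U4 @\<^sub>c V4) * Q4"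
  have [simp]: "dim_row F1 = r2 + k" "dim_col F1 = r2" "dim_row W1 = r4 + m" "dim_col W1 = r4"
    "dim_row G2 = r3" "dim_col G2 = r3 + h" "dim_row W2 = r4" "dim_col W2 = r4 + n"
    by (simp_all add: F1_def W1_def G2_def W2_def)
  define RT RB CL CR where
    "RT = (L1 @\<^sub>c 0\<^sub>m r1 r2 @\<^sub>c 0\<^sub>m r1 r3 @\<^sub>c 0\<^sub>m r1 r4) @\<^sub>r (M1 @\<^sub>c F1 @\<^sub>c 0\<^sub>m (r2 + k) r3 @\<^sub>c 0\<^sub>m (r2 + k) r4)"
    and "RB = (E1 @\<^sub>c X @\<^sub>c L3 @\<^sub>c 0\<^sub>m r3 r4) @\<^sub>r (E2 @\<^sub>c K @\<^sub>c M3 @\<^sub>c W1)"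
    and "CL = (U1 @\<^sub>c V1) @\<^sub>r 0\<^sub>m r2 (r1 + (r3 + h)) @\<^sub>r (0\<^sub>m r3 r1 @\<^sub>c G2) @\<^sub>r 0\<^sub>m r4 (r1 + (r3 + h))"
    and "CR = (D1 @\<^sub>c D2) @\<^sub>r (U2 @\<^sub>c V2) @\<^sub>r (0\<^sub>m r3 r2 @\<^sub>c O') @\<^sub>r (0\<^sub>m r4 r2 @\<^sub>c W2)"
  let ?r = "r1 + (r2 + (r3 + r4))"
  have dims [simp]: "dim_row RT = r1 + (r2 + k)" "dim_col RT = ?r" "dim_row RB = r3 + (r4 + m)" "dim_col RB = ?r"
    "dim_row CL = ?r" "dim_col CL = r1 + (r3 + h)" "dim_row CR = ?r" "dim_col CR = r2 + (r4 + n)"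
    by (simp_all add: RT_def RB_def CL_def CR_def)
  have PLM: "P * (L @\<^sub>r M) = P1 * RT @\<^sub>r P3 * RB"
  proof -
    let ?R1 = "L1 @\<^sub>c 0\<^sub>m r1 r2 @\<^sub>c 0\<^sub>m r1 r3 @\<^sub>c 0\<^sub>m r1 r4" and ?R2 = "M11 @\<^sub>c L2 @\<^sub>c 0\<^sub>m r2 r3 @\<^sub>c 0\<^sub>m r2 r4"
    let ?R3 = "E1 @\<^sub>c X @\<^sub>c L3 @\<^sub>c 0\<^sub>m r3 r4" and ?R4 = "E21 @\<^sub>c K1 @\<^sub>c M31 @\<^sub>c L4"
    let ?R5 = "M12 @\<^sub>c M2 @\<^sub>c 0\<^sub>m k r3 @\<^sub>c 0\<^sub>m k r4" and ?R6 = "E22 @\<^sub>c K2 @\<^sub>c M32 @\<^sub>c M4"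
    have 1: "P2 * (?R2 @\<^sub>r ?R5) = M1 @\<^sub>c F1 @\<^sub>c 0\<^sub>m (r2 + k) r3 @\<^sub>c 0\<^sub>m (r2 + k) r4"
      by (simp add: append_rows_append_cols append_rows_zero mult_append_cols mult_zero_dim M1 F1_def)
    have 2: "P4 * (?R4 @\<^sub>r ?R6) = E2 @\<^sub>c K @\<^sub>c M3 @\<^sub>c W1"
      by (simp add: append_rows_append_cols mult_append_cols E2 K M3 W1_def)
    have 3: "L @\<^sub>r M = (?R1 @\<^sub>r ?R2 @\<^sub>r ?R3 @\<^sub>r ?R4) @\<^sub>r (?R5 @\<^sub>r ?R6)"
      by (simp add: L_def M_def block_mat_def)
    have 4: "P * ((?R1 @\<^sub>r ?R2 @\<^sub>r ?R3 @\<^sub>r ?R4) @\<^sub>r (?R5 @\<^sub>r ?R6))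
        = P1 * (?R1 @\<^sub>r P2 * (?R2 @\<^sub>r ?R5)) @\<^sub>r P3 * (?R3 @\<^sub>r P4 * (?R4 @\<^sub>r ?R6))"
      unfolding P_def by (rule pluq_left_factor[where c = ?r]) simp_all
    show ?thesis unfolding 3 4 1 2 RT_def RB_def ..
  qed
  have UVQ: "(U @\<^sub>c V) * Q = CL * Q1 @\<^sub>c CR * Q2"
  proof -
    let ?C1 = "U1 @\<^sub>r 0\<^sub>m r2 r1 @\<^sub>r 0\<^sub>m r3 r1 @\<^sub>r 0\<^sub>m r4 r1" and ?C2 = "D1 @\<^sub>r U2 @\<^sub>r 0\<^sub>m r3 r2 @\<^sub>r 0\<^sub>m r4 r2"
    let ?C3 = "V11 @\<^sub>r 0\<^sub>m r2 r3 @\<^sub>r U3 @\<^sub>r 0\<^sub>m r4 r3" and ?C4 = "D21 @\<^sub>r V21 @\<^sub>r O1 @\<^sub>r U4"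
    let ?C5 = "V12 @\<^sub>r 0\<^sub>m r2 h @\<^sub>r V3 @\<^sub>r 0\<^sub>m r4 h" and ?C6 = "D22 @\<^sub>r V22 @\<^sub>r O2 @\<^sub>r V4"
    have "(?C3 @\<^sub>c ?C5) * Q3 = V1 @\<^sub>r 0\<^sub>m r2 (r3 + h) @\<^sub>r G2 @\<^sub>r 0\<^sub>m r4 (r3 + h)"
      by (simp add: append_rows_append_cols[symmetric] append_cols_zero append_rows_mult mult_zero_dim V1 G2_def)
    then have 1: "?C1 @\<^sub>c (?C3 @\<^sub>c ?C5) * Q3 = CL"
      by (simp add: append_rows_append_cols[symmetric] append_cols_zero CL_def)
    have "(?C4 @\<^sub>c ?C6) * Q4 = D2 @\<^sub>r V2 @\<^sub>r O' @\<^sub>r W2"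
      by (simp add: append_rows_append_cols[symmetric] append_rows_mult D2 V2 O' W2_def)
    then have 2: "?C2 @\<^sub>c (?C4 @\<^sub>c ?C6) * Q4 = CR"
      by (simp add: append_rows_append_cols[symmetric] CR_def)
    have 3: "U @\<^sub>c V = (?C1 @\<^sub>c ?C2 @\<^sub>c ?C3 @\<^sub>c ?C4) @\<^sub>c (?C5 @\<^sub>c ?C6)"
      by (simp add: U_def V_def block_mat_def append_rows_append_cols)
    have 4: "((?C1 @\<^sub>c ?C2 @\<^sub>c ?C3 @\<^sub>c ?C4) @\<^sub>c (?C5 @\<^sub>c ?C6)) * Q
        = (?C1 @\<^sub>c (?C3 @\<^sub>c ?C5) * Q3) * Q1 @\<^sub>c (?C2 @\<^sub>c (?C4 @\<^sub>c ?C6) * Q4) * Q2"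
      unfolding Q_def by (rule pluq_right_factor[where c = ?r]) simp_all
    show ?thesis unfolding 3 4 1 2 ..
  qed
  have dimLM: "dim_row (L @\<^sub>r M) = r1 + (r2 + (r3 + r4)) + (k + m)" "dim_col (L @\<^sub>r M) = ?r"
    "dim_row (U @\<^sub>c V) = ?r" "dim_col (U @\<^sub>c V) = ?r + (h + n)"
    by (simp_all add: L_def M_def U_def V_def block_mat_def)
  have dimPQ: "dim_col P = r1 + (r2 + (r3 + r4)) + (k + m)" "dim_row Q = ?r + (h + n)"
    by (simp_all add: P_def Q_def)
  have "P * ((L @\<^sub>r M) * (U @\<^sub>c V)) * Q = (P * (L @\<^sub>r M)) * ((U @\<^sub>c V) * Q)"
    using dimLM dimPQ by (simp add: mult_assoc_dim del: dim_append_rows dim_append_cols)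
  also have "\<dots> = (P1 * RT * (CL * Q1) @\<^sub>c P1 * RT * (CR * Q2)) @\<^sub>r (P3 * RB * (CL * Q1) @\<^sub>c P3 * RB * (CR * Q2))"
    unfolding PLM UVQ by (rule append_rows_mult_append_cols) simp_all
  also have "P1 * RT * (CL * Q1) = A1"
  proof -
    have "RT * CL = (L1 @\<^sub>r M1) * (U1 @\<^sub>c V1)"
      by (simp add: RT_def CL_def append_rows_mult append_cols_mult_append_rows mult_zero_dim add_zero_dim)
    then show ?thesis by (simp add: A1 mult_assoc_dim) (simp add: mult_assoc_dim[symmetric])
  qed
  also have "P1 * RT * (CR * Q2) = A2"
  proof -
    have "RT * CR * Q2 = L1 * D @\<^sub>r (M1 * D + F)"
      by (simp add: RT_def CR_def append_rows_mult append_cols_mult_append_rows mult_zero_dim add_zero_dim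
          D F F1_def mult_assoc_dim add_mult_distrib_mat[of _ "r2 + k" "r2 + (r4 + n)" _ _ "r2 + (r4 + n)"] carrier_matI)
    then show ?thesis by (simp add: A2 mult_assoc_dim)
  qed
  also have "P3 * RB * (CL * Q1) = A3"
  proof -
    have "RB * CL = (E1 @\<^sub>r E2) * (U1 @\<^sub>c V1) + (L3 @\<^sub>r M3) * (0\<^sub>m r3 r1 @\<^sub>c G2)"
      by (simp add: RB_def CL_def append_rows_mult append_cols_mult_append_rows mult_zero_dim add_zero_dim add_append_rows)
    moreover have "P3 * ((E1 @\<^sub>r E2) * (U1 @\<^sub>c V1) + (L3 @\<^sub>r M3) * (0\<^sub>m r3 r1 @\<^sub>c G2))
        = E * (U1 @\<^sub>c V1) + P3 * (L3 @\<^sub>r M3) * (0\<^sub>m r3 r1 @\<^sub>c G2)"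
      by (subst mult_add_distrib_mat[of _ "r3 + (r4 + m)" "r3 + (r4 + m)" _ "r1 + (r3 + h)"])
         (auto simp: E mult_assoc_dim intro!: carrier_matI)
    moreover have "G = P3 * ((L3 @\<^sub>r M3) * G2)"
      by (simp add: G G2_def mult_assoc_dim)
    then have "E * (U1 @\<^sub>c V1) + P3 * (L3 @\<^sub>r M3) * (0\<^sub>m r3 r1 @\<^sub>c G2) = E * U1 @\<^sub>c (E * V1 + G)"
      by (simp add: mult_append_cols mult_zero_dim add_append_cols add_zero_dim mult_assoc_dim)
    ultimately show ?thesis by (simp add: A3 mult_assoc_dim) (simp add: mult_assoc_dim[symmetric])
  qed
  also have "P3 * RB * (CR * Q2) = A4"
  proof -
    have WW: "W = W1 * W2" by (simp add: W W1_def W2_def mult_assoc_dim)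
    let ?X = "(E1 @\<^sub>r E2) * (D1 @\<^sub>c D2)"
    let ?Y = "(X * U2 @\<^sub>c (X * V2 + L3 * O')) @\<^sub>r (K * U2 @\<^sub>c (K * V2 + (M3 * O' + W)))"
    have "RB * CR = ?X + ?Y"
      unfolding append_rows_mult_append_cols[of E1 E2 D1 D2, simplified]
      by (simp add: RB_def CR_def append_rows_mult append_cols_mult_append_rows mult_append_cols mult_zero_dim add_zero_dim
          add_append_rows add_append_cols WW)
    then have "P3 * (RB * CR) * Q2 = P3 * (?X + ?Y) * Q2" by (simp only:)
    also have "P3 * (?X + ?Y) * Q2 = P3 * ?X * Q2 + P3 * ?Y * Q2"
      by (simp add: mult_add_dim add_mult_dim)
    also have "P3 * ?X * Q2 = E * D"
      by (simp add: E D mult_assoc_dim)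
    also have "P3 * ?Y * Q2 = H"
      by (simp only: H)
    finally have "P3 * (RB * CR) * Q2 = A4" by (simp only: A4)
    then show ?thesis by (simp add: mult_assoc_dim)
  qed
  finally show ?thesis .
qed


section \<open>Correctness\<close>

text \<open>The invariant of the recursion.\<close>

fun pluq_spec :: "nat \<Rightarrow> nat \<Rightarrow> 'a::field mat \<Rightarrow> 'a pluq \<Rightarrow> bool" where
  "pluq_spec m n A (P, Q, r, L, M, U, V) \<longleftrightarrow>
     r \<le> m \<and> r \<le> n \<and> orthogonal_matrix m P \<and> orthogonal_matrix n Q \<and>
     dim_row L = r \<and> dim_col L = r \<and> dim_row M = m - r \<and> dim_col M = r \<and>
     dim_row U = r \<and> dim_col U = r \<and> dim_row V = r \<and> dim_col V = n - r \<and>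
     unit_lower_triangular L \<and> nonsingular_upper U \<and>
     A = P * ((L @\<^sub>r M) * (U @\<^sub>c V)) * Q"

fun pluq_rank :: "'a pluq \<Rightarrow> nat" where
  "pluq_rank (P, Q, r, L, M, U, V) = r"

text \<open>Both factors have inner dimension \<open>0\<close>, so their product is the zero matrix.\<close>

lemma pluq_spec_zero: "pluq_spec m n (0\<^sub>m m n) (pluq_zero m n)"
  by (auto simp: pluq_zero_def orthogonal_one unit_lower_triangular_def upper_triangular_def nonsingular_upper_def
      scalar_prod_def intro!: eq_matI)

lemma pluq_row_spec:
  fixes A :: "'a::field mat"
  assumes A: "A \<in> carrier_mat 1 n"
  shows "pluq_spec 1 n A (fst (pluq_row n A))"
proof (cases "A = 0\<^sub>m 1 n")
  case True
  then show ?thesis using pluq_spec_zero[of 1 n] by (simp add: pluq_row_def)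
next
  case False
  define i where "i = (LEAST j. j < n \<and> A $$ (0, j) \<noteq> 0)"
  define T where "T = (swaprows_mat n 0 i :: 'a mat)"
  obtain U V where UV: "split_cols (A * T) 1 = (U, V)" by (rule prod.exhaust)
  have "\<exists>j. j < n \<and> A $$ (0, j) \<noteq> 0"
  proof (rule ccontr)
    assume "\<not> ?thesis"
    then have "A = 0\<^sub>m 1 n" using A by (intro eq_matI) auto
    then show False using False by simp
  qed
  from LeastI_ex[OF this] have i: "i < n" "A $$ (0, i) \<noteq> 0"
    unfolding i_def by simp_all
  then have T: "orthogonal_matrix n T" "T * T = 1\<^sub>m n"
    by (auto simp: T_def orthogonal_swaprows swaprows_mat_inv)
  note dT = orthogonal_matrixD(1,2)[OF T(1)]
  have dims: "dim_row U = 1" "dim_row V = 1" "dim_col U = 1" "dim_col V = n - 1" and AT: "A * T = U @\<^sub>c V"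
    using split_cols_append[OF UV] A i dT by auto
  have "col T 0 = unit_vec n i"
    using i(1) by (intro eq_vecI) (auto simp: T_def)
  then have "(A * T) $$ (0, 0) = A $$ (0, i)"
    using A i dT by (simp add: scalar_prod_right_unit)
  then have "U $$ (0, 0) \<noteq> 0" using AT dims i by simp
  then have "nonsingular_upper U"
    using dims by (simp add: nonsingular_upper_def upper_triangular_def)
  moreover have "A * T * T = A"
    using A T(2) dT by (simp add: mult_assoc_dim mult_one_dim)
  moreover have "fst (pluq_row n A) = (1\<^sub>m 1, T, 1, 1\<^sub>m 1, 0\<^sub>m 0 1, U, V)"
    using False UV by (simp add: pluq_row_def Let_def i_def[symmetric] T_def[symmetric])
  ultimately show ?thesis
    using T(1) dims dT i A
    by (simp add: orthogonal_one unit_lower_triangular_def upper_triangular_def AT[symmetric] mult_one_dim)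
qed

text \<open>The swap brings the pivot \<open>a\<close> to the top, so that \<open>[L; M]\<close> is the swapped column divided by \<open>a\<close>. At
  most \<open>m - 1\<close> divisions are spent, and none for the zero column, whose rank is \<open>0\<close>.\<close>

lemma pluq_col_spec:
  fixes A :: "'a::field mat"
  assumes A: "A \<in> carrier_mat m 1"
  shows "pluq_spec m 1 A (fst (pluq_col m A))"
    and "snd (pluq_col m A) \<le> m * pluq_rank (fst (pluq_col m A))"
proof -
  show "pluq_spec m 1 A (fst (pluq_col m A))"
  proof (cases "A = 0\<^sub>m m 1")
    case True
    then show ?thesis using pluq_spec_zero[of m 1] by (simp add: pluq_col_def)
  next
    case False
    define i where "i = (LEAST j. j < m \<and> A $$ (j, 0) \<noteq> 0)"
    define a where "a = A $$ (i, 0)"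
    define T where "T = (swaprows_mat m 0 i :: 'a mat)"
    let ?X = "map_mat (\<lambda>x. x / a) (T * A)"
    obtain L M where LM: "split_rows ?X 1 = (L, M)" by (rule prod.exhaust)
    have "\<exists>j. j < m \<and> A $$ (j, 0) \<noteq> 0"
    proof (rule ccontr)
      assume "\<not> ?thesis"
      then have "A = 0\<^sub>m m 1" using A by (intro eq_matI) auto
      then show False using False by simp
    qed
    from LeastI_ex[OF this] have i: "i < m" "a \<noteq> 0"
      unfolding i_def a_def by simp_all
    then have T: "orthogonal_matrix m T" "T * T = 1\<^sub>m m"
      by (auto simp: T_def orthogonal_swaprows swaprows_mat_inv)
    note dT = orthogonal_matrixD(1,2)[OF T(1)]
    have dims: "dim_row L = 1" "dim_row M = m - 1" "dim_col L = 1" "dim_col M = 1" and X: "?X = L @\<^sub>r M"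
      using split_rows_append[OF LM] A i dT by auto
    have "row T 0 = unit_vec m i"
      using i(1) by (intro eq_vecI) (auto simp: T_def)
    moreover have "col A 0 \<in> carrier_vec m" using A by (auto intro: carrier_vecI)
    ultimately have "(T * A) $$ (0, 0) = a"
      using A i dT by (simp add: a_def scalar_prod_left_unit)
    then have "?X $$ (0, 0) = 1" using i A dT by simp
    then have "L $$ (0, 0) = 1" using X dims i by simp
    then have "unit_lower_triangular L"
      using dims by (simp add: unit_lower_triangular_def upper_triangular_def)
    moreover have "?X * mat 1 1 (\<lambda>_. a) = T * A"
      using i A dT by (intro eq_matI) (auto simp: scalar_prod_def)
    moreover have "T * (T * A) = A"
      using A T(2) dT by (simp add: mult_assoc_dim[symmetric] mult_one_dim)
    moreover have "fst (pluq_col m A) = (T, 1\<^sub>m 1, 1, L, M, mat 1 1 (\<lambda>_. a), 0\<^sub>m 1 0)"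
      using False LM by (simp add: pluq_col_def Let_def i_def[symmetric] T_def[symmetric] a_def[symmetric])
    ultimately show ?thesis
      using T(1) dims dT i A
      by (simp add: orthogonal_one nonsingular_upper_def upper_triangular_def X[symmetric] mult_one_dim)
  qed
  show "snd (pluq_col m A) \<le> m * pluq_rank (fst (pluq_col m A))"
    by (auto simp: pluq_col_def Let_def split: prod.split)
qed

declare diag_block_mat.simps [simp del] mul_counted.simps [simp del]
  lsolve_counted.simps [simp del] usolve_counted.simps [simp del]

section \<open>Cost of the routines\<close>

text \<open>One constant \<open>c\<close> for all three routines.\<close>

locale pluq_routines =
  fixes \<omega> c :: real
    and mm :: "nat \<Rightarrow> nat \<Rightarrow> nat \<Rightarrow> 'a::field slp"
    and lsolve usolve :: "nat \<Rightarrow> nat \<Rightarrow> 'a slp"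
  assumes omega: "2 < \<omega>" and c: "0 \<le> c"
    and mm: "mm_routine \<omega> mm" and lsolve: "lower_solve_routine \<omega> lsolve" and usolve: "upper_solve_routine \<omega> usolve"
    and mm_ops: "\<And>a s b. s \<le> min a b \<Longrightarrow> real (slp_ops (mm a s b)) \<le> c * real a * real b * real s powr (\<omega> - 2)"
    and lsolve_ops: "\<And>s b. s \<le> b \<Longrightarrow> real (slp_ops (lsolve s b)) \<le> c * real b * real s powr (\<omega> - 1)"
    and usolve_ops: "\<And>s b. s \<le> b \<Longrightarrow> real (slp_ops (usolve s b)) \<le> c * real b * real s powr (\<omega> - 1)"
begin

abbreviation R :: "'a routines" where "R \<equiv> (mm, lsolve, usolve)"

text \<open>A solve with an \<open>s \<times> s\<close> triangular matrix is no more expensive than a product, since one factor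
  \<open>s\<close> of \<open>s powr (\<omega> - 1)\<close> is bounded by a dimension of the matrix.\<close>

lemma solve_bound:
  assumes "real t \<le> c * real b * real s powr (\<omega> - 1)" "s \<le> x" "b \<le> y" "s \<le> r"
  shows "real t \<le> (c + 1) * real x * real y * real r powr (\<omega> - 2)"
proof -
  have "real s powr (\<omega> - 1) = real s * real s powr (\<omega> - 2)"
    using powr_add[of "real s" 1 "\<omega> - 2"] by (cases "s = 0") (simp_all add: algebra_simps)
  also have "\<dots> \<le> real x * real r powr (\<omega> - 2)"
    using assms omega by (intro mult_mono powr_mono2) auto
  finally have "c * real b * real s powr (\<omega> - 1) \<le> c * real y * (real x * real r powr (\<omega> - 2))"
    using assms c by (intro mult_mono) auto
  also have "\<dots> \<le> (c + 1) * real y * (real x * real r powr (\<omega> - 2))"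
    by (intro mult_right_mono) auto
  finally show ?thesis using assms(1) by (simp add: mult_ac)
qed

lemma lsolve_counted_ops:
  assumes "dim_row L \<le> x" "dim_row L \<le> y" "dim_col B \<le> y" "dim_row L \<le> r"
  shows "real (snd (lsolve_counted R L B)) \<le> (c + 1) * real x * real y * real r powr (\<omega> - 2)"
  using assms lsolve_ops[of "dim_row L" "max (dim_row L) (dim_col B)"]
  by (intro solve_bound[where b = "max (dim_row L) (dim_col B)" and s = "dim_row L"])
     (auto simp: lsolve_counted.simps Let_def)

lemma usolve_counted_ops:
  assumes "dim_row U \<le> x" "dim_row U \<le> y" "dim_row C \<le> x" "dim_row U \<le> r"
  shows "real (snd (usolve_counted R C U)) \<le> (c + 1) * real x * real y * real r powr (\<omega> - 2)"
  using assms usolve_ops[of "dim_row U" "max (dim_row U) (dim_row C)"]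
    solve_bound[where b = "max (dim_row U) (dim_row C)" and s = "dim_row U" and x = y and y = x
      and t = "snd (usolve_counted R C U)" and r = r]
  by (auto simp: usolve_counted.simps Let_def mult_ac)

text \<open>The additional \<open>1\<close> in \<open>c + 1\<close> pays for the subtraction of the product. This fits into the bound because
  products with inner dimension \<open>0\<close> are skipped, so that \<open>r powr (\<omega> - 2) \<ge> 1\<close> whenever something is
  subtracted.\<close>

lemma sub_mul_counted_ops:
  assumes "dim_col A \<le> x" "dim_col A \<le> y" "dim_row A \<le> x" "dim_col B \<le> y" "dim_row C \<le> x" "dim_col C \<le> y"
    and "dim_col A \<le> r"
  shows "real (snd (sub_mul_counted R C A B)) \<le> (c + 1) * real x * real y * real r powr (\<omega> - 2)"
proof (cases "dim_col A = 0")
  case True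
  then show ?thesis using c by (simp add: sub_mul_counted_def)
next
  case False
  define s a b where "s = dim_col A" and "a = max s (dim_row A)" and "b = max s (dim_col B)"
  have sr: "real s powr (\<omega> - 2) \<le> real r powr (\<omega> - 2)"
    using assms(7) omega by (intro powr_mono2) (auto simp: s_def)
  have "real (slp_ops (mm a s b)) \<le> c * real a * real b * real s powr (\<omega> - 2)"
    by (rule mm_ops) (simp add: a_def b_def)
  also have "\<dots> \<le> c * real x * real y * real r powr (\<omega> - 2)"
    using assms c sr by (intro mult_mono) (auto simp: a_def b_def s_def)
  finally have 1: "real (slp_ops (mm a s b)) \<le> c * real x * real y * real r powr (\<omega> - 2)" .
  have "1 \<le> real r powr (\<omega> - 2)"
    using False assms(7) omega by (intro ge_one_powr_ge_zero) auto
  then have "real (dim_row C) * real (dim_col C) * 1 \<le> real x * real y * real r powr (\<omega> - 2)"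
    using assms by (intro mult_mono) auto
  then have "real (snd (sub_mul_counted R C A B)) \<le> c * real x * real y * real r powr (\<omega> - 2)
      + real x * real y * real r powr (\<omega> - 2)"
    using 1 False
    by (simp add: sub_mul_counted_def mul_counted.simps Let_def s_def a_def b_def)
  then show ?thesis by (simp add: algebra_simps)
qed

section \<open>One level of the recursion\<close>

text \<open>The trace of one call with \<open>m, n > 1\<close>. It yields both the correctness of the result and the
  recurrence for the cost, in which the twelve summands \<open>(c + 1) m n r powr (\<omega> - 2)\<close> stand for the six
  triangular solves and the six multiplications with subtraction. The correctness of the recursive
  calls is used throughout: the shapes of the blocks, the solvability of the triangular systems and the
  meaning of \<open>F, G, H, W\<close> depend on it.\<close>

lemma pluq_step:
  assumes A: "A \<in> carrier_mat m n" and mn: "1 < m" "1 < n"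
    and IH: "\<And>m' n' A'. m' + n' < m + n \<Longrightarrow> A' \<in> carrier_mat m' n' \<Longrightarrow> pluq_spec m' n' A' (fst (pluq R m' n' A'))"
  defines "k \<equiv> m div 2" and "h \<equiv> n div 2"
  obtains A1 F G W r1 r2 r3 r4 where
    "A1 \<in> carrier_mat k h" "r1 = pluq_rank (fst (pluq R k h A1))"
    "F \<in> carrier_mat (k - r1) (n - h)" "r2 = pluq_rank (fst (pluq R (k - r1) (n - h) F))"
    "G \<in> carrier_mat (m - k) (h - r1)" "r3 = pluq_rank (fst (pluq R (m - k) (h - r1) G))"
    "W \<in> carrier_mat (m - k - r3) (n - h - r2)" "r4 = pluq_rank (fst (pluq R (m - k - r3) (n - h - r2) W))"
    "pluq_spec m n A (fst (pluq R m n A))" "pluq_rank (fst (pluq R m n A)) = r1 + r2 + r3 + r4"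
    "real (snd (pluq R m n A)) \<le> real (snd (pluq R k h A1)) + real (snd (pluq R (k - r1) (n - h) F))
       + real (snd (pluq R (m - k) (h - r1) G)) + real (snd (pluq R (m - k - r3) (n - h - r2) W))
       + 12 * (c + 1) * real m * real n * real (r1 + r2 + r3 + r4) powr (\<omega> - 2)"
proof -
  have dA: "dim_row A = m" "dim_col A = n" using A by auto
  have kh: "k \<le> m" "h \<le> n" "k < m" "h < n" "0 < k" "0 < h" using mn by (auto simp: k_def h_def)

  obtain A1 A2 A3 A4 where sA: "split_block A k h = (A1, A2, A3, A4)" by (rule prod_cases4)
  note A_split = split_block_append[OF sA, unfolded dA, OF kh(1,2)]
  obtain P1 Q1 r1 L1 M1 U1 V1 where res1: "fst (pluq R k h A1) = (P1, Q1, r1, L1, M1, U1, V1)"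
    by (rule prod_cases7)
  have spec1: "pluq_spec k h A1 (P1, Q1, r1, L1, M1, U1, V1)"
    unfolding res1[symmetric] by (rule IH) (use kh A_split(1,5) in auto)
  then have r1: "r1 \<le> k" "r1 \<le> h" and o1: "orthogonal_matrix k P1" "orthogonal_matrix h Q1"
    and d1: "dim_row L1 = r1" "dim_col L1 = r1" "dim_row M1 = k - r1" "dim_col M1 = r1"
      "dim_row U1 = r1" "dim_col U1 = r1" "dim_row V1 = r1" "dim_col V1 = h - r1"
    and t1: "unit_lower_triangular L1" "nonsingular_upper U1"
    and A1: "A1 = P1 * ((L1 @\<^sub>r M1) * (U1 @\<^sub>c V1)) * Q1"
    by simp_all
  note p1 = orthogonal_matrixD(1,2)[OF o1(1)] orthogonal_matrixD(1,2)[OF o1(2)]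

  obtain B1 B2 where sB: "split_rows (P1\<^sup>T * A2) r1 = (B1, B2)" by (rule prod.exhaust)
  obtain C1 C2 where sC: "split_cols (A3 * Q1\<^sup>T) r1 = (C1, C2)" by (rule prod.exhaust)
  note B = split_rows_append[OF sB] and C = split_cols_append[OF sC]
  have B_dims: "dim_row B1 = r1" "dim_row B2 = k - r1" "dim_col B1 = n - h" "dim_col B2 = n - h"
    and B_eq: "P1\<^sup>T * A2 = B1 @\<^sub>r B2"
    using B(1-5) A_split(2,7) r1(1) p1 by simp_all
  have C_dims: "dim_row C1 = m - k" "dim_row C2 = m - k" "dim_col C1 = r1" "dim_col C2 = h - r1"
    and C_eq: "A3 * Q1\<^sup>T = C1 @\<^sub>c C2"
    using C(1-5) A_split(3,6) r1(2) p1 by simp_all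
  define D where "D = fst (lsolve_counted R L1 B1)"
  define E where "E = fst (usolve_counted R C1 U1)"
  have D: "dim_row D = r1" "dim_col D = n - h" "L1 * D = B1"
    unfolding D_def by (simp_all only: fst_lsolve_counted[OF lsolve t1(1) d1(1,2) B_dims(1)] B_dims)
  have u1: "upper_triangular U1" "\<forall>i < r1. U1 $$ (i, i) \<noteq> 0"
    using t1(2) unfolding nonsingular_upper_def d1 by blast+
  have E: "dim_row E = m - k" "dim_col E = r1" "E * U1 = C1"
    unfolding E_def
    by (simp_all only: fst_usolve_counted[OF usolve u1 d1(5,6) C_dims(3)] C_dims)
  define F where "F = fst (sub_mul_counted R B2 M1 D)"
  define G where "G = fst (sub_mul_counted R C2 E V1)"
  define H where "H = fst (sub_mul_counted R A4 E D)"
  have F: "F = B2 - M1 * D" unfolding F_def by (rule fst_sub_mul_counted[OF mm]) (simp_all only: d1 D B_dims)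
  have G: "G = C2 - E * V1" unfolding G_def by (rule fst_sub_mul_counted[OF mm]) (simp_all only: d1 E C_dims)
  have H: "H = A4 - E * D" unfolding H_def by (rule fst_sub_mul_counted[OF mm]) (simp_all only: E D A_split(4,8))
  have FGH_dims: "dim_row F = k - r1" "dim_col F = n - h" "dim_row G = m - k" "dim_col G = h - r1"
    "dim_row H = m - k" "dim_col H = n - h"
    by (simp_all only: F G H index_minus_mat(2,3) index_mult_mat(2,3) d1 D(1,2) E(1,2))

  obtain P2 Q2 r2 L2 M2 U2 V2 where res2: "fst (pluq R (k - r1) (n - h) F) = (P2, Q2, r2, L2, M2, U2, V2)"
    by (rule prod_cases7)
  have "pluq_spec (k - r1) (n - h) F (P2, Q2, r2, L2, M2, U2, V2)"
    unfolding res2[symmetric] by (rule IH) (use kh FGH_dims(1,2) in auto)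
  then have r2: "r2 \<le> k - r1" "r2 \<le> n - h" and o2: "orthogonal_matrix (k - r1) P2" "orthogonal_matrix (n - h) Q2"
    and d2: "dim_row L2 = r2" "dim_col L2 = r2" "dim_row M2 = k - r1 - r2" "dim_col M2 = r2"
      "dim_row U2 = r2" "dim_col U2 = r2" "dim_row V2 = r2" "dim_col V2 = n - h - r2"
    and t2: "unit_lower_triangular L2" "nonsingular_upper U2"
    and F': "F = P2 * ((L2 @\<^sub>r M2) * (U2 @\<^sub>c V2)) * Q2"
    by simp_all
  note p2 = orthogonal_matrixD(1,2)[OF o2(1)] orthogonal_matrixD(1,2)[OF o2(2)]
  obtain P3 Q3 r3 L3 M3 U3 V3 where res3: "fst (pluq R (m - k) (h - r1) G) = (P3, Q3, r3, L3, M3, U3, V3)"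
    by (rule prod_cases7)
  have "pluq_spec (m - k) (h - r1) G (P3, Q3, r3, L3, M3, U3, V3)"
    unfolding res3[symmetric] by (rule IH) (use kh FGH_dims(3,4) in auto)
  then have r3: "r3 \<le> m - k" "r3 \<le> h - r1" and o3: "orthogonal_matrix (m - k) P3" "orthogonal_matrix (h - r1) Q3"
    and d3: "dim_row L3 = r3" "dim_col L3 = r3" "dim_row M3 = m - k - r3" "dim_col M3 = r3"
      "dim_row U3 = r3" "dim_col U3 = r3" "dim_row V3 = r3" "dim_col V3 = h - r1 - r3"
    and t3: "unit_lower_triangular L3" "nonsingular_upper U3"
    and G': "G = P3 * ((L3 @\<^sub>r M3) * (U3 @\<^sub>c V3)) * Q3"
    by simp_all
  note p3 = orthogonal_matrixD(1,2)[OF o3(1)] orthogonal_matrixD(1,2)[OF o3(2)]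

  obtain H1 H2 H3 H4 where sH: "split_block (P3\<^sup>T * H * Q2\<^sup>T) r3 r2 = (H1, H2, H3, H4)" by (rule prod_cases4)
  obtain E1 E2 where sE: "split_rows (P3\<^sup>T * E) r3 = (E1, E2)" by (rule prod.exhaust)
  obtain M11 M12 where sM1: "split_rows (P2\<^sup>T * M1) r2 = (M11, M12)" by (rule prod.exhaust)
  obtain D1 D2 where sD: "split_cols (D * Q2\<^sup>T) r2 = (D1, D2)" by (rule prod.exhaust)
  obtain V11 V12 where sV1: "split_cols (V1 * Q3\<^sup>T) r3 = (V11, V12)" by (rule prod.exhaust)
  have "r3 \<le> dim_row (P3\<^sup>T * H * Q2\<^sup>T)" "r2 \<le> dim_col (P3\<^sup>T * H * Q2\<^sup>T)"
    by (simp_all only: index_mult_mat(2,3) index_transpose_mat(2,3) p2 p3 r2 r3)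
  note sH_split = split_block_append[OF sH this]
  have H_dims: "dim_row H1 = r3" "dim_row H2 = r3" "dim_row H3 = m - k - r3" "dim_row H4 = m - k - r3"
      "dim_col H1 = r2" "dim_col H3 = r2" "dim_col H2 = n - h - r2" "dim_col H4 = n - h - r2"
    and H_eq: "P3\<^sup>T * H * Q2\<^sup>T = (H1 @\<^sub>c H2) @\<^sub>r (H3 @\<^sub>c H4)"
    by (simp_all only: sH_split(1-8) index_mult_mat(2,3) index_transpose_mat(2,3) p2 p3 r2 r3) (fact sH_split(9))
  have "r3 \<le> dim_row (P3\<^sup>T * E)"
    by (simp_all only: index_mult_mat(2,3) index_transpose_mat(2,3) p3 r3)
  note sE_split = split_rows_append[OF sE this]
  have E_dims: "dim_row E1 = r3" "dim_row E2 = m - k - r3" "dim_col E1 = r1" "dim_col E2 = r1"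
    and E_eq: "P3\<^sup>T * E = E1 @\<^sub>r E2"
    by (simp_all only: sE_split(1-4) index_mult_mat(2,3) index_transpose_mat(2,3) p3 r3 E) (fact sE_split(5))
  have "r2 \<le> dim_row (P2\<^sup>T * M1)"
    by (simp_all only: index_mult_mat(2,3) index_transpose_mat(2,3) p2 r2)
  note sM1_split = split_rows_append[OF sM1 this]
  have M1_dims: "dim_row M11 = r2" "dim_row M12 = k - r1 - r2" "dim_col M11 = r1" "dim_col M12 = r1"
    and M1_eq: "P2\<^sup>T * M1 = M11 @\<^sub>r M12"
    by (simp_all only: sM1_split(1-4) index_mult_mat(2,3) index_transpose_mat(2,3) p2 r2 d1) (fact sM1_split(5))
  have "r2 \<le> dim_col (D * Q2\<^sup>T)"
    by (simp_all only: index_mult_mat(2,3) index_transpose_mat(2,3) p2 r2)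
  note sD_split = split_cols_append[OF sD this]
  have D_dims: "dim_row D1 = r1" "dim_row D2 = r1" "dim_col D1 = r2" "dim_col D2 = n - h - r2"
    and D_eq: "D * Q2\<^sup>T = D1 @\<^sub>c D2"
    by (simp_all only: sD_split(1-4) index_mult_mat(2,3) index_transpose_mat(2,3) p2 r2 D) (fact sD_split(5))
  have "r3 \<le> dim_col (V1 * Q3\<^sup>T)"
    by (simp_all only: index_mult_mat(2,3) index_transpose_mat(2,3) p3 r3)
  note sV1_split = split_cols_append[OF sV1 this]
  have V1_dims: "dim_row V11 = r1" "dim_row V12 = r1" "dim_col V11 = r3" "dim_col V12 = h - r1 - r3"
    and V1_eq: "V1 * Q3\<^sup>T = V11 @\<^sub>c V12"
    by (simp_all only: sV1_split(1-4) index_mult_mat(2,3) index_transpose_mat(2,3) p3 r3 d1) (fact sV1_split(5))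

  define X where "X = fst (usolve_counted R H1 U2)"
  define J where "J = fst (lsolve_counted R L3 X)"
  define K where "K = fst (usolve_counted R H3 U2)"
  define N where "N = fst (lsolve_counted R L3 H2)"
  have u2: "upper_triangular U2" "\<forall>i < r2. U2 $$ (i, i) \<noteq> 0"
    using t2(2) unfolding nonsingular_upper_def d2 by blast+
  have X: "dim_row X = r3" "dim_col X = r2" "X * U2 = H1"
    unfolding X_def
    by (simp_all only: fst_usolve_counted[OF usolve u2 d2(5,6) H_dims(5)] H_dims)
  have K: "dim_row K = m - k - r3" "dim_col K = r2" "K * U2 = H3"
    unfolding K_def
    by (simp_all only: fst_usolve_counted[OF usolve u2 d2(5,6) H_dims(6)] H_dims)
  have J: "dim_row J = r3" "dim_col J = r2" "L3 * J = X"
    unfolding J_def by (simp_all only: fst_lsolve_counted[OF lsolve t3(1) d3(1,2) X(1)] X(2))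
  have N: "dim_row N = r3" "dim_col N = n - h - r2" "L3 * N = H2"
    unfolding N_def by (simp_all only: fst_lsolve_counted[OF lsolve t3(1) d3(1,2) H_dims(2)] H_dims)
  define O' where "O' = fst (sub_mul_counted R N J V2)"
  define W' where "W' = fst (sub_mul_counted R H4 K V2)"
  define W where "W = fst (sub_mul_counted R W' M3 O')"
  have O': "O' = N - J * V2" unfolding O'_def by (rule fst_sub_mul_counted[OF mm]) (simp_all only: d2 N(1,2) J(1,2))
  have W': "W' = H4 - K * V2" unfolding W'_def by (rule fst_sub_mul_counted[OF mm]) (simp_all only: d2 K(1,2) H_dims)
  have O'_dims: "dim_row O' = r3" "dim_col O' = n - h - r2" by (simp_all only: O' index_minus_mat(2,3) index_mult_mat(2,3) J(1,2) d2)
  have W: "W = W' - M3 * O'"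
    unfolding W_def by (rule fst_sub_mul_counted[OF mm]) (simp_all only: W' index_minus_mat(2,3) index_mult_mat(2,3) d2 d3 K(1,2) O'_dims)
  have W_dims: "dim_row W' = m - k - r3" "dim_col W' = n - h - r2" "dim_row W = m - k - r3" "dim_col W = n - h - r2"
    by (simp_all only: W W' index_minus_mat(2,3) index_mult_mat(2,3) d2 d3 K(1,2) O'_dims)

  obtain P4 Q4 r4 L4 M4 U4 V4 where
    res4: "fst (pluq R (m - k - r3) (n - h - r2) W) = (P4, Q4, r4, L4, M4, U4, V4)"
    by (rule prod_cases7)
  have "pluq_spec (m - k - r3) (n - h - r2) W (P4, Q4, r4, L4, M4, U4, V4)"
    unfolding res4[symmetric] by (rule IH) (use kh W_dims(3,4) in auto)
  then have r4: "r4 \<le> m - k - r3" "r4 \<le> n - h - r2"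
    and o4: "orthogonal_matrix (m - k - r3) P4" "orthogonal_matrix (n - h - r2) Q4"
    and d4: "dim_row L4 = r4" "dim_col L4 = r4" "dim_row M4 = m - k - r3 - r4" "dim_col M4 = r4"
      "dim_row U4 = r4" "dim_col U4 = r4" "dim_row V4 = r4" "dim_col V4 = n - h - r2 - r4"
    and t4: "unit_lower_triangular L4" "nonsingular_upper U4"
    and W4: "W = P4 * ((L4 @\<^sub>r M4) * (U4 @\<^sub>c V4)) * Q4"
    by simp_all
  note p4 = orthogonal_matrixD(1,2)[OF o4(1)] orthogonal_matrixD(1,2)[OF o4(2)]

  obtain E21 E22 where sE2: "split_rows (P4\<^sup>T * E2) r4 = (E21, E22)" by (rule prod.exhaust)
  obtain M31 M32 where sM3: "split_rows (P4\<^sup>T * M3) r4 = (M31, M32)" by (rule prod.exhaust)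
  obtain K1 K2 where sK: "split_rows (P4\<^sup>T * K) r4 = (K1, K2)" by (rule prod.exhaust)
  obtain D21 D22 where sD2: "split_cols (D2 * Q4\<^sup>T) r4 = (D21, D22)" by (rule prod.exhaust)
  obtain V21 V22 where sV2: "split_cols (V2 * Q4\<^sup>T) r4 = (V21, V22)" by (rule prod.exhaust)
  obtain O1 O2 where sO: "split_cols (O' * Q4\<^sup>T) r4 = (O1, O2)" by (rule prod.exhaust)
  define k' m' h' n' where "k' = k - r1 - r2" and "m' = m - k - r3 - r4"
    and "h' = h - r1 - r3" and "n' = n - h - r2 - r4"
  have "r4 \<le> dim_row (P4\<^sup>T * E2)"
    by (simp_all only: index_mult_mat(2,3) index_transpose_mat(2,3) p4 r4)
  note sE2_split = split_rows_append[OF sE2 this]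
  have E2_dims: "dim_row E21 = r4" "dim_row E22 = m'" "dim_col E21 = r1" "dim_col E22 = r1"
    and E2_eq: "P4\<^sup>T * E2 = E21 @\<^sub>r E22"
    by (simp_all only: sE2_split(1-4) index_mult_mat(2,3) index_transpose_mat(2,3) p4 r4 E_dims m'_def n'_def) (fact sE2_split(5))
  have "r4 \<le> dim_row (P4\<^sup>T * M3)"
    by (simp_all only: index_mult_mat(2,3) index_transpose_mat(2,3) p4 r4)
  note sM3_split = split_rows_append[OF sM3 this]
  have M3_dims: "dim_row M31 = r4" "dim_row M32 = m'" "dim_col M31 = r3" "dim_col M32 = r3"
    and M3_eq: "P4\<^sup>T * M3 = M31 @\<^sub>r M32"
    by (simp_all only: sM3_split(1-4) index_mult_mat(2,3) index_transpose_mat(2,3) p4 r4 d3 m'_def n'_def) (fact sM3_split(5))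
  have "r4 \<le> dim_row (P4\<^sup>T * K)"
    by (simp_all only: index_mult_mat(2,3) index_transpose_mat(2,3) p4 r4)
  note sK_split = split_rows_append[OF sK this]
  have K_dims: "dim_row K1 = r4" "dim_row K2 = m'" "dim_col K1 = r2" "dim_col K2 = r2"
    and K_eq: "P4\<^sup>T * K = K1 @\<^sub>r K2"
    by (simp_all only: sK_split(1-4) index_mult_mat(2,3) index_transpose_mat(2,3) p4 r4 K m'_def n'_def) (fact sK_split(5))
  have "r4 \<le> dim_col (D2 * Q4\<^sup>T)"
    by (simp_all only: index_mult_mat(2,3) index_transpose_mat(2,3) p4 r4)
  note sD2_split = split_cols_append[OF sD2 this]
  have D2_dims: "dim_row D21 = r1" "dim_row D22 = r1" "dim_col D21 = r4" "dim_col D22 = n'"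
    and D2_eq: "D2 * Q4\<^sup>T = D21 @\<^sub>c D22"
    by (simp_all only: sD2_split(1-4) index_mult_mat(2,3) index_transpose_mat(2,3) p4 r4 D_dims m'_def n'_def) (fact sD2_split(5))
  have "r4 \<le> dim_col (V2 * Q4\<^sup>T)"
    by (simp_all only: index_mult_mat(2,3) index_transpose_mat(2,3) p4 r4)
  note sV2_split = split_cols_append[OF sV2 this]
  have V2_dims: "dim_row V21 = r2" "dim_row V22 = r2" "dim_col V21 = r4" "dim_col V22 = n'"
    and V2_eq: "V2 * Q4\<^sup>T = V21 @\<^sub>c V22"
    by (simp_all only: sV2_split(1-4) index_mult_mat(2,3) index_transpose_mat(2,3) p4 r4 d2 m'_def n'_def) (fact sV2_split(5))
  have "r4 \<le> dim_col (O' * Q4\<^sup>T)"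
    by (simp_all only: index_mult_mat(2,3) index_transpose_mat(2,3) p4 r4)
  note sO_split = split_cols_append[OF sO this]
  have O_dims: "dim_row O1 = r3" "dim_row O2 = r3" "dim_col O1 = r4" "dim_col O2 = n'"
    and O_eq: "O' * Q4\<^sup>T = O1 @\<^sub>c O2"
    by (simp_all only: sO_split(1-4) index_mult_mat(2,3) index_transpose_mat(2,3) p4 r4 O'_dims m'_def n'_def) (fact sO_split(5))

  have sz: "k = r1 + (r2 + k')" "k - r1 = r2 + k'" "k - r1 - r2 = k'"
    "m - k = r3 + (r4 + m')" "m - k - r3 = r4 + m'" "m - k - r3 - r4 = m'"
    "h = r1 + (r3 + h')" "h - r1 = r3 + h'" "h - r1 - r3 = h'"
    "n - h = r2 + (r4 + n')" "n - h - r2 = r4 + n'" "n - h - r2 - r4 = n'"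
    using r1 r2 r3 r4 by (simp_all add: k'_def m'_def h'_def n'_def)

  let ?P = "diag_block_mat [P1 * diag_block_mat [1\<^sub>m r1, P2], P3 * diag_block_mat [1\<^sub>m r3, P4]]
           * pluq_S (r1 + r2) (r3 + r4) k' m'"
  let ?Q = "pluq_T r1 r2 r3 r4 h' n'
           * diag_block_mat [diag_block_mat [1\<^sub>m r1, Q3] * Q1, diag_block_mat [1\<^sub>m r2, Q4] * Q2]"
  let ?L = "block_mat
           [[L1, 0\<^sub>m r1 r2, 0\<^sub>m r1 r3, 0\<^sub>m r1 r4],
            [M11, L2, 0\<^sub>m r2 r3, 0\<^sub>m r2 r4],
            [E1, X, L3, 0\<^sub>m r3 r4],
            [E21, K1, M31, L4]]"
  let ?M = "block_mat
           [[M12, M2, 0\<^sub>m k' r3, 0\<^sub>m k' r4],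
            [E22, K2, M32, M4]]"
  let ?U = "block_mat
           [[U1, D1, V11, D21],
            [0\<^sub>m r2 r1, U2, 0\<^sub>m r2 r3, V21],
            [0\<^sub>m r3 r1, 0\<^sub>m r3 r2, U3, O1],
            [0\<^sub>m r4 r1, 0\<^sub>m r4 r2, 0\<^sub>m r4 r3, U4]]"
  let ?V = "block_mat
           [[V12, D22],
            [0\<^sub>m r2 h', V22],
            [V3, O2],
            [0\<^sub>m r4 h', V4]]"
  let ?r = "r1 + r2 + r3 + r4"

  have mn01: "m \<noteq> 0" "n \<noteq> 0" "m \<noteq> 1" "n \<noteq> 1" using mn by auto
  note trace = k_def[symmetric] h_def[symmetric] sA res1 sB sC D_def[symmetric] E_def[symmetric]
    F_def[symmetric] G_def[symmetric] H_def[symmetric] res2 res3 sH sE sM1 sD sV1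
    X_def[symmetric] J_def[symmetric] K_def[symmetric] N_def[symmetric] O'_def[symmetric] W'_def[symmetric]
    W_def[symmetric] res4 sE2 sM3 sK sD2 sV2 sO
    k'_def[symmetric] m'_def[symmetric] h'_def[symmetric] n'_def[symmetric]
  have result: "fst (pluq R m n A) = (?P, ?Q, ?r, ?L, ?M, ?U, ?V)"
    unfolding pluq.simps[of R m n A] Let_def
    by (simp only: mn01 if_False simp_thms fst_bind_counted counted_simps trace prod.case)
  have cost: "snd (pluq R m n A) = snd (pluq R k h A1) + (snd (lsolve_counted R L1 B1) + (snd (usolve_counted R C1 U1)
      + (snd (sub_mul_counted R B2 M1 D) + (snd (sub_mul_counted R C2 E V1) + (snd (sub_mul_counted R A4 E D)
      + (snd (pluq R (k - r1) (n - h) F) + (snd (pluq R (m - k) (h - r1) G)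
      + (snd (usolve_counted R H1 U2) + (snd (lsolve_counted R L3 X) + (snd (usolve_counted R H3 U2)
      + (snd (lsolve_counted R L3 H2) + (snd (sub_mul_counted R N J V2) + (snd (sub_mul_counted R H4 K V2)
      + (snd (sub_mul_counted R W' M3 O') + snd (pluq R (m - k - r3) (n - h - r2) W)))))))))))))))"
    unfolding pluq.simps[of R m n A] Let_def
    by (simp only: mn01 if_False simp_thms fst_bind_counted snd_bind_counted counted_simps trace prod.case add_0_right)

  \<comment> \<open>Longer differences are replaced before their subterms, which also occur in \<open>sz\<close>.\<close>
  note block_dims = p1 p2 p3 p4 d1 d2 d3 d4 D(1,2) E(1,2) X(1,2) K(1,2) O'_dims E_dims M1_dims D_dims V1_dims
    E2_dims M3_dims K_dims D2_dims V2_dims O_dims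
  note block_dims = block_dims[unfolded sz(3,6,9,12), unfolded sz(2,5,8,11), unfolded sz(4,10), unfolded sz(1,7)]
  have factorization: "?P * ((?L @\<^sub>r ?M) * (?U @\<^sub>c ?V)) * ?Q = (A1 @\<^sub>c A2) @\<^sub>r (A3 @\<^sub>c A4)"
  proof (rule pluq_assemble[where ?D = D and ?E = E and ?X = X and ?K = K and ?O' = O' and ?F = F and ?G = G
        and ?H = H and ?W = W and ?D2.0 = D2 and ?E2.0 = E2])
    show "A1 = P1 * ((L1 @\<^sub>r M1) * (U1 @\<^sub>c V1)) * Q1" by (fact A1)
    show "F = P2 * ((L2 @\<^sub>r M2) * (U2 @\<^sub>c V2)) * Q2" by (fact F')
    show "G = P3 * ((L3 @\<^sub>r M3) * (U3 @\<^sub>c V3)) * Q3" by (fact G')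
    show "W = P4 * ((L4 @\<^sub>r M4) * (U4 @\<^sub>c V4)) * Q4" by (fact W4)
    have "M1 * D + F = B2"
      unfolding F by (rule add_minus_cancel_dim) (simp_all only: index_mult_mat(2,3) d1 D(1,2) B_dims)
    then show "A2 = P1 * (L1 * D @\<^sub>r (M1 * D + F))"
      using orthogonal_cancel(1)[OF o1(1), of A2] A_split(2) by (simp only: D B_eq)
    have "E * V1 + G = C2"
      unfolding G by (rule add_minus_cancel_dim) (simp_all only: index_mult_mat(2,3) d1 E(1,2) C_dims)
    then show "A3 = (E * U1 @\<^sub>c (E * V1 + G)) * Q1"
      using orthogonal_cancel_right[OF o1(2), of A3] A_split(6) by (simp only: E C_eq)
    show "A4 = E * D + H"
      unfolding H by (rule add_minus_cancel_dim[symmetric]) (simp_all only: index_mult_mat(2,3) E(1,2) D(1,2) A_split(4,8))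
    have "L3 * O' = L3 * N - L3 * (J * V2)"
      unfolding O' by (rule mult_minus_dim) (simp_all add: d2 d3 N(1,2) J(1,2))
    also have "L3 * (J * V2) = L3 * J * V2"
      by (rule mult_assoc_dim[symmetric]) (simp_all add: d2 d3 J(1,2))
    finally have "L3 * O' = H2 - X * V2" by (simp only: N(3) J(3))
    then have 1: "X * V2 + L3 * O' = H2"
      by (simp add: add_minus_cancel_dim d2 X(1,2) H_dims)
    have "M3 * O' + W = W'"
      unfolding W by (rule add_minus_cancel_dim) (simp_all add: d3 O'_dims W_dims(1,2))
    then have 2: "K * V2 + (M3 * O' + W) = H4"
      by (simp add: W' add_minus_cancel_dim d2 K(1,2) H_dims)
    have "H = P3 * (P3\<^sup>T * (H * Q2\<^sup>T * Q2))"
      by (simp add: orthogonal_cancel(1)[OF o3(1)] orthogonal_cancel_right[OF o2(2)] FGH_dims)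
    also have "\<dots> = P3 * (P3\<^sup>T * H * Q2\<^sup>T) * Q2"
      by (simp add: mult_assoc_dim p2 p3 FGH_dims)
    finally show "H = P3 * ((X * U2 @\<^sub>c (X * V2 + L3 * O')) @\<^sub>r (K * U2 @\<^sub>c (K * V2 + (M3 * O' + W)))) * Q2"
      by (simp only: 1 2 X K H_eq)
    show "E = P3 * (E1 @\<^sub>r E2)"
      using orthogonal_cancel(1)[OF o3(1), of E] E by (simp only: E_eq)
    show "M1 = P2 * (M11 @\<^sub>r M12)"
      using orthogonal_cancel(1)[OF o2(1), of M1] d1 by (simp only: M1_eq)
    show "D = (D1 @\<^sub>c D2) * Q2"
      using orthogonal_cancel_right[OF o2(2), of D] D by (simp only: D_eq)
    show "V1 = (V11 @\<^sub>c V12) * Q3"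
      using orthogonal_cancel_right[OF o3(2), of V1] d1 by (simp only: V1_eq)
    show "E2 = P4 * (E21 @\<^sub>r E22)"
      using orthogonal_cancel(1)[OF o4(1), of E2] E_dims by (simp only: E2_eq)
    show "M3 = P4 * (M31 @\<^sub>r M32)"
      using orthogonal_cancel(1)[OF o4(1), of M3] d3 by (simp only: M3_eq)
    show "K = P4 * (K1 @\<^sub>r K2)"
      using orthogonal_cancel(1)[OF o4(1), of K] K by (simp only: K_eq)
    show "D2 = (D21 @\<^sub>c D22) * Q4"
      using orthogonal_cancel_right[OF o4(2), of D2] D_dims by (simp only: D2_eq)
    show "V2 = (V21 @\<^sub>c V22) * Q4"
      using orthogonal_cancel_right[OF o4(2), of V2] d2 by (simp only: V2_eq)
    show "O' = (O1 @\<^sub>c O2) * Q4"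
      using orthogonal_cancel_right[OF o4(2), of O'] O'_dims by (simp only: O_eq)
  qed (fact block_dims refl)+

  have P: "orthogonal_matrix m ?P"
  proof -
    have "orthogonal_matrix (r1 + (k - r1)) (diag_block_mat [1\<^sub>m r1, P2])"
      "orthogonal_matrix (r3 + (m - k - r3)) (diag_block_mat [1\<^sub>m r3, P4])"
      by (intro orthogonal_diag_block orthogonal_one o2 o4)+
    moreover have "r1 + (k - r1) = k" "r3 + (m - k - r3) = m - k" using r1 r3 by simp_all
    ultimately have "orthogonal_matrix k (P1 * diag_block_mat [1\<^sub>m r1, P2])"
      "orthogonal_matrix (m - k) (P3 * diag_block_mat [1\<^sub>m r3, P4])"
      by (intro orthogonal_mult o1 o3; simp only:)+
    then have "orthogonal_matrix (k + (m - k)) (diag_block_mat [P1 * diag_block_mat [1\<^sub>m r1, P2], P3 * diag_block_mat [1\<^sub>m r3, P4]])"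
      by (rule orthogonal_diag_block)
    moreover have "k + (m - k) = m" "(r1 + r2) + ((r3 + r4) + (k' + m')) = m"
      using kh(1,2) sz(1,4) by linarith+
    moreover have "orthogonal_matrix ((r1 + r2) + ((r3 + r4) + (k' + m'))) (pluq_S (r1 + r2) (r3 + r4) k' m' :: 'a mat)"
      by (rule orthogonal_pluq_S)
    ultimately show ?thesis by (intro orthogonal_mult) (simp_all only:)
  qed
  have Q: "orthogonal_matrix n ?Q"
  proof -
    have "orthogonal_matrix (r1 + (h - r1)) (diag_block_mat [1\<^sub>m r1, Q3])"
      "orthogonal_matrix (r2 + (n - h - r2)) (diag_block_mat [1\<^sub>m r2, Q4])"
      by (intro orthogonal_diag_block orthogonal_one o3 o4)+
    moreover have "r1 + (h - r1) = h" "r2 + (n - h - r2) = n - h" using r1 r2 by simp_all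
    ultimately have "orthogonal_matrix h (diag_block_mat [1\<^sub>m r1, Q3] * Q1)"
      "orthogonal_matrix (n - h) (diag_block_mat [1\<^sub>m r2, Q4] * Q2)"
      by (intro orthogonal_mult o1 o2; simp only:)+
    then have "orthogonal_matrix (h + (n - h)) (diag_block_mat [diag_block_mat [1\<^sub>m r1, Q3] * Q1, diag_block_mat [1\<^sub>m r2, Q4] * Q2])"
      by (rule orthogonal_diag_block)
    moreover have "h + (n - h) = n" "r1 + (r2 + (r3 + (r4 + (h' + n')))) = n"
      using kh(1,2) sz(7,10) by linarith+
    moreover have "orthogonal_matrix (r1 + (r2 + (r3 + (r4 + (h' + n'))))) (pluq_T r1 r2 r3 r4 h' n' :: 'a mat)"
      by (rule orthogonal_pluq_T)
    ultimately show ?thesis by (intro orthogonal_mult) (simp_all only:)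
  qed
  have L: "unit_lower_triangular ?L"
    by (rule unit_lower_triangular_block) (fact d1 d2 d3 d4 M1_dims E_dims E2_dims X K_dims M3_dims t1 t2 t3 t4)+
  have U: "nonsingular_upper ?U"
    by (rule nonsingular_upper_block) (fact d1 d2 d3 d4 D_dims V1_dims D2_dims V2_dims O_dims t1 t2 t3 t4)+
  have "m = (r1 + (r2 + k')) + (r3 + (r4 + m'))"
    using le_add_diff_inverse[OF kh(1), symmetric] unfolding sz(4) by (simp only: sz(1)[symmetric])
  moreover have "n = (r1 + (r3 + h')) + (r2 + (r4 + n'))"
    using le_add_diff_inverse[OF kh(2), symmetric] unfolding sz(10) by (simp only: sz(7)[symmetric])
  ultimately have rmn: "?r \<le> m" "?r \<le> n" "m - ?r = k' + m'" "n - ?r = h' + n'"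
    by simp_all
  have "dim_row ?L = ?r" "dim_col ?L = ?r" "dim_row ?M = k' + m'" "dim_col ?M = ?r"
    "dim_row ?U = ?r" "dim_col ?U = ?r" "dim_row ?V = ?r" "dim_col ?V = h' + n'"
    by (simp_all add: block_mat_def block_dims add.assoc)
  then have spec: "pluq_spec m n A (fst (pluq R m n A))"
    unfolding result pluq_spec.simps factorization rmn(3,4)
    by (intro conjI rmn(1,2) P Q L U A_split(9))

  have ranks: "r1 \<le> m" "r1 \<le> n" "r2 \<le> m" "r2 \<le> n" "r3 \<le> m" "r3 \<le> n"
    "r1 \<le> ?r" "r2 \<le> ?r" "r3 \<le> ?r"
    using rmn(1,2) by linarith+
  have sizes: "k - r1 \<le> m" "n - h \<le> n" "m - k \<le> m" "h - r1 \<le> n" "m - k - r3 \<le> m" "n - h - r2 \<le> n"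
    using kh(1,2) by (simp_all add: le_diff_conv)
  let ?c = "(c + 1) * real m * real n * real ?r powr (\<omega> - 2)"
  note dims = d1 d2 d3 B_dims C_dims D(1,2) E(1,2) A_split(1-8) H_dims X(1,2) K(1,2) J(1,2) N(1,2) O'_dims W_dims
  have c12: "real (snd (lsolve_counted R L1 B1)) \<le> ?c" "real (snd (lsolve_counted R L3 X)) \<le> ?c"
    "real (snd (lsolve_counted R L3 H2)) \<le> ?c"
    "real (snd (usolve_counted R C1 U1)) \<le> ?c" "real (snd (usolve_counted R H1 U2)) \<le> ?c"
    "real (snd (usolve_counted R H3 U2)) \<le> ?c"
    "real (snd (sub_mul_counted R B2 M1 D)) \<le> ?c" "real (snd (sub_mul_counted R C2 E V1)) \<le> ?c"
    "real (snd (sub_mul_counted R A4 E D)) \<le> ?c" "real (snd (sub_mul_counted R N J V2)) \<le> ?c"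
    "real (snd (sub_mul_counted R H4 K V2)) \<le> ?c" "real (snd (sub_mul_counted R W' M3 O')) \<le> ?c"
    by (intro lsolve_counted_ops usolve_counted_ops sub_mul_counted_ops; simp only: dims ranks sizes)+
  show thesis
  proof (rule that)
    show "A1 \<in> carrier_mat k h" using A_split(1,5) by auto
    show "F \<in> carrier_mat (k - r1) (n - h)" "G \<in> carrier_mat (m - k) (h - r1)"
      "W \<in> carrier_mat (m - k - r3) (n - h - r2)"
      using FGH_dims(1-4) W_dims(3,4) by auto
    show "real (snd (pluq R m n A)) \<le> real (snd (pluq R k h A1)) + real (snd (pluq R (k - r1) (n - h) F))
       + real (snd (pluq R (m - k) (h - r1) G)) + real (snd (pluq R (m - k - r3) (n - h - r2) W))
       + 12 * (c + 1) * real m * real n * real ?r powr (\<omega> - 2)"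
      using c12 unfolding cost of_nat_add by linarith
    show "pluq_spec m n A (fst (pluq R m n A))" by (fact spec)
  qed (simp_all only: res1 res2 res3 res4 result pluq_rank.simps)
qed

end


section \<open>Rank\<close>

lemma nonsingular_upper_det:
  fixes U :: "'a::field mat"
  assumes "nonsingular_upper U" "U \<in> carrier_mat r r"
  shows "det U \<noteq> 0"
proof -
  have "det U = prod_list (diag_mat U)"
    using assms by (intro det_upper_triangular[where n = r]) (auto simp: nonsingular_upper_def)
  then show ?thesis
    using assms by (auto simp: prod_list_zero_iff diag_mat_def nonsingular_upper_def)
qed

lemma unit_lower_triangular_det:
  fixes L :: "'a::field mat"
  assumes "unit_lower_triangular L" "L \<in> carrier_mat r r"
  shows "det L \<noteq> 0"
proof -
  have "nonsingular_upper L\<^sup>T"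
    using assms by (auto simp: unit_lower_triangular_def nonsingular_upper_def)
  then have "det L\<^sup>T \<noteq> 0"
    using assms(2) by (intro nonsingular_upper_det[where r = r]) auto
  then show ?thesis using det_transpose[OF assms(2)] by simp
qed

text \<open>The columns of \<open>A B\<close> are linear combinations of those of \<open>A\<close>.\<close>

lemma (in vec_space) rank_mult_le:
  assumes A: "A \<in> carrier_mat n k" and B: "B \<in> carrier_mat k l"
  shows "rank (A * B) \<le> rank A"
proof -
  let ?W = "span (set (cols A))" and ?X = "span (set (cols (A * B)))"
  have cA: "set (cols A) \<subseteq> carrier_vec n" and cAB: "set (cols (A * B)) \<subseteq> carrier_vec n"
    using cols_dim[of A] cols_dim[of "A * B"] A by auto
  have "set (cols (A * B)) \<subseteq> ?W"
  proof
    fix v assume "v \<in> set (cols (A * B))"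
    then obtain j where j: "j < l" "v = col (A * B) j"
      using B by (auto simp: cols_def)
    have "v = A *\<^sub>v col B j" by (simp only: j(2) col_mult2[OF A B j(1)])
    also have "\<dots> \<in> ?W"
      using A B j(1) col_space_eq[OF A] unfolding col_space_def by auto
    finally show "v \<in> ?W" .
  qed
  then have sub: "?X \<subseteq> ?W"
    using cA by (simp add: span_is_subset span_is_submodule)
  have sW: "subspace class_ring ?W V" and sX: "subspace class_ring ?X V"
    using span_is_subspace cA cAB by auto
  have AB: "A * B \<in> carrier_mat n l" using A B by simp
  show ?thesis
    unfolding rank_def
    using vectorspace.subspace_dim[OF subspace_is_vs[OF sW] nested_subspaces[OF sW sX sub]]
      fin_dim_span_cols[OF A] fin_dim_span_cols[OF AB] by simp
qed

lemma mult_unit_vec: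
  fixes A :: "'a::semiring_1 mat"
  assumes "A \<in> carrier_mat n k" "j < k"
  shows "A *\<^sub>v unit_vec k j = col A j"
  using assms by (intro eq_vecI) (auto simp: scalar_prod_right_unit[of _ k])

lemma (in vec_space) rank_eq_dim_col_if_injective:
  assumes A: "A \<in> carrier_mat n k" and inj: "\<And>v. v \<in> carrier_vec k \<Longrightarrow> A *\<^sub>v v = 0\<^sub>v n \<Longrightarrow> v = 0\<^sub>v k"
  shows "rank A = k"
proof (rule lin_indpt_full_rank[OF A])
  show dist: "distinct (cols A)"
  proof (rule ccontr)
    assume "\<not> distinct (cols A)"
    then obtain i j where ij: "i < k" "j < k" "i \<noteq> j" "col A i = col A j"
      using A by (auto simp: distinct_conv_nth)
    have "A *\<^sub>v (unit_vec k i - unit_vec k j) = A *\<^sub>v unit_vec k i - A *\<^sub>v unit_vec k j"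
      using A by (intro mult_minus_distrib_mat_vec) auto
    also have "\<dots> = 0\<^sub>v n"
      using A ij by (simp add: mult_unit_vec)
    finally have "unit_vec k i - unit_vec k j = (0\<^sub>v k :: 'a vec)"
      by (intro inj) auto
    then have "(unit_vec k i - unit_vec k j) $ i = (0\<^sub>v k :: 'a vec) $ i" by simp
    then show False using ij by simp
  qed
  show "lin_indpt (set (cols A))"
    using lin_depE[OF A _ dist] inj by metis
qed

text \<open>The first \<open>r\<close> columns of \<open>A Q\<^sup>T\<close> form the matrix \<open>P [L U; M U]\<close>. It has full column rank, because
  \<open>P\<close> and \<open>L U\<close> are invertible.\<close>

lemma pluq_spec_rank:
  fixes A :: "'a::field mat"
  assumes spec: "pluq_spec m n A res"
  shows "pluq_rank res \<le> vec_space.rank m A"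
proof -
  obtain P Q r L M U V where res: "res = (P, Q, r, L, M, U, V)" by (rule prod_cases7)
  have r: "r \<le> m" "r \<le> n" and o: "orthogonal_matrix m P" "orthogonal_matrix n Q"
    and d: "dim_row L = r" "dim_col L = r" "dim_row M = m - r" "dim_col M = r"
      "dim_row U = r" "dim_col U = r" "dim_row V = r" "dim_col V = n - r"
    and t: "unit_lower_triangular L" "nonsingular_upper U"
    and A: "A = P * ((L @\<^sub>r M) * (U @\<^sub>c V)) * Q"
    using spec by (simp_all add: res)
  note p = orthogonal_matrixD(1,2)[OF o(1)] orthogonal_matrixD(1,2)[OF o(2)]
  interpret vec_space "TYPE('a)" m .
  define I where "I = (1\<^sub>m r @\<^sub>r 0\<^sub>m (n - r) r :: 'a mat)"
  define Z where "Z = P * ((L * U) @\<^sub>r (M * U))"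
  have dI: "dim_row I = n" "dim_col I = r" using r by (simp_all add: I_def)
  have dZ: "dim_row Z = m" "dim_col Z = r" using p d by (simp_all add: Z_def)
  \<comment> \<open>Multiplication by \<open>I\<close> selects the first \<open>r\<close> columns.\<close>
  have "A * (Q\<^sup>T * I) = P * ((L @\<^sub>r M) * (U @\<^sub>c V)) * (Q * (Q\<^sup>T * I))"
    unfolding A using r p d dI by (simp add: mult_assoc_dim)
  also have "Q * (Q\<^sup>T * I) = I"
    by (rule orthogonal_cancel(1)[OF o(2) dI(1)])
  also have "P * ((L @\<^sub>r M) * (U @\<^sub>c V)) * I = P * ((L @\<^sub>r M) * ((U @\<^sub>c V) * I))"
    using r p d dI by (simp add: mult_assoc_dim)
  also have "(U @\<^sub>c V) * I = U"
    using d by (simp add: I_def append_cols_mult_append_rows mult_zero_dim add_zero_dim mult_one_dim)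
  also have "P * ((L @\<^sub>r M) * U) = Z"
    using d by (simp add: Z_def append_rows_mult)
  finally have AZ: "A * (Q\<^sup>T * I) = Z" .
  have "rank Z = r"
  proof (rule rank_eq_dim_col_if_injective)
    show "Z \<in> carrier_mat m r" using dZ by auto
    fix v :: "'a vec" assume v: "v \<in> carrier_vec r" and "Z *\<^sub>v v = 0\<^sub>v m"
    have "P\<^sup>T *\<^sub>v (Z *\<^sub>v v) = (P\<^sup>T * Z) *\<^sub>v v"
      using p dZ v by (intro assoc_mult_mat_vec[of _ m m _ r, symmetric]) auto
    also have "P\<^sup>T * Z = (L * U) @\<^sub>r (M * U)"
      unfolding Z_def using r d by (intro orthogonal_cancel(2)[OF o(1)]) simp
    also have "\<dots> *\<^sub>v v = (L * U *\<^sub>v v) @\<^sub>v (M * U *\<^sub>v v)"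
      by (rule mat_mult_append[of _ r r _ "m - r"]) (use d v in auto)
    finally have "P\<^sup>T *\<^sub>v (Z *\<^sub>v v) = (L * U *\<^sub>v v) @\<^sub>v (M * U *\<^sub>v v)" .
    moreover have "P\<^sup>T *\<^sub>v (Z *\<^sub>v v) = 0\<^sub>v m"
      using p \<open>Z *\<^sub>v v = 0\<^sub>v m\<close> by (intro eq_vecI) (auto simp: scalar_prod_def)
    ultimately have app: "(L * U *\<^sub>v v) @\<^sub>v (M * U *\<^sub>v v) = 0\<^sub>v m" by simp
    have "L * U *\<^sub>v v = 0\<^sub>v r"
    proof (rule eq_vecI)
      fix i assume i: "i < dim_vec (0\<^sub>v r :: 'a vec)"
      then have "(L * U *\<^sub>v v) $ i = ((L * U *\<^sub>v v) @\<^sub>v (M * U *\<^sub>v v)) $ i" using d by simp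
      then show "(L * U *\<^sub>v v) $ i = 0\<^sub>v r $ i" using i r by (simp add: app)
    qed (simp add: d)
    moreover have "det (L * U) \<noteq> 0"
      using unit_lower_triangular_det[OF t(1), of r] nonsingular_upper_det[OF t(2), of r] d
      by (subst det_mult[of _ r]) auto
    moreover have "L * U \<in> carrier_mat r r" using d by auto
    ultimately show "v = 0\<^sub>v r"
      using det_0_iff_vec_prod_zero_field[of "L * U" r] v by blast
  qed
  moreover have "A \<in> carrier_mat m n"
    unfolding A by (rule carrier_matI) (simp_all only: index_mult_mat(2,3) p)
  then have "rank Z \<le> rank A"
    unfolding AZ[symmetric] by (rule rank_mult_le) (rule carrier_matI; simp only: index_mult_mat(2,3) index_transpose_mat(2,3) p dI)
  ultimately show ?thesis by (simp only: res pluq_rank.simps)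
qed

section \<open>The recurrence\<close>

text \<open>A concave power lies below its tangent line at \<open>q\<close>. For \<open>x > 0\<close> and \<open>t = ln (x / q)\<close> this is the weighted mean
  of \<open>1 + u \<le> exp u\<close> at \<open>u = - g t\<close> and \<open>u = (1 - g) t\<close>, multiplied by \<open>exp (g t)\<close>.\<close>

lemma powr_le_linear:
  fixes x g q :: real
  assumes "0 \<le> x" "0 < q" "0 < g" "g \<le> 1"
  shows "x powr g \<le> q powr g * (1 - g) + q powr g * g * x / q"
proof (cases "x = 0")
  case True
  then show ?thesis using assms by simp
next
  case False
  define t where "t = ln (x / q)"
  have xq: "x / q = exp t" using False assms by (simp add: t_def)
  then have t: "x powr g = q powr g * exp (g * t)"
    using False assms by (simp add: powr_def t_def ln_div exp_add[symmetric] algebra_simps)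
  have "(1 - g) * (1 + - (g * t)) + g * (1 + (1 - g) * t) \<le> (1 - g) * exp (- (g * t)) + g * exp ((1 - g) * t)"
    using assms by (intro add_mono mult_left_mono exp_ge_add_one_self) auto
  then have "exp (g * t) * 1 \<le> exp (g * t) * ((1 - g) * exp (- (g * t)) + g * exp ((1 - g) * t))"
    by (intro mult_left_mono) (auto simp: algebra_simps)
  also have "\<dots> = (1 - g) + g * exp t"
    by (simp add: distrib_left mult.left_commute exp_add[symmetric]) (simp add: algebra_simps)
  finally have "q powr g * exp (g * t) \<le> q powr g * ((1 - g) + g * exp t)"
    by (intro mult_left_mono) auto
  then show ?thesis by (simp add: t xq[symmetric] distrib_left mult.assoc)
qed

text \<open>For \<open>b \<ge> 1\<close> the sum is at most \<open>q\<close>, as \<open>x\<^sub>i powr b \<le> x\<^sub>i\<close>. For \<open>b < 1\<close> it would be Hoelder's inequality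
  with exponents \<open>1 / b\<close> and \<open>1 / (1 - b)\<close>, but the tangent of \<open>x powr b\<close> at \<open>q\<close> is enough: the term
  \<open>p\<^sub>i x\<^sub>i / q\<close> that it produces is at most \<open>x\<^sub>i\<close>. The exponent \<open>min b 1\<close> covers both cases.\<close>

lemma weighted_powr_sum_le:
  fixes p x :: "nat \<Rightarrow> real"
  assumes "finite I" and p: "\<And>i. i \<in> I \<Longrightarrow> 0 \<le> p i \<and> p i \<le> q" "sum p I \<le> 1"
    and x: "\<And>i. i \<in> I \<Longrightarrow> 0 \<le> x i" "sum x I \<le> 1" and q: "0 < q" and b: "0 < b"
  shows "(\<Sum>i\<in>I. p i * x i powr b) \<le> q powr min b 1"
proof -
  define g where "g = min b 1"
  have g: "0 < g" "g \<le> 1" "g \<le> b" using b by (auto simp: g_def)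
  have "(\<Sum>i\<in>I. p i * x i powr b) \<le> (\<Sum>i\<in>I. q powr g * (1 - g) * p i + q powr g * g * x i)"
  proof (rule sum_mono)
    fix i assume i: "i \<in> I"
    have "x i \<le> sum x I" using assms(1) i x(1) by (intro member_le_sum) auto
    then have "x i powr b \<le> x i powr g"
      using x i g by (intro powr_mono') auto
    also have "\<dots> \<le> q powr g * (1 - g) + q powr g * g * x i / q"
      by (rule powr_le_linear) (use x i q g in auto)
    finally have "p i * x i powr b \<le> p i * (q powr g * (1 - g) + q powr g * g * x i / q)"
      using p i by (intro mult_left_mono) auto
    also have "\<dots> = q powr g * (1 - g) * p i + q powr g * g * x i * (p i / q)"
      by (simp add: algebra_simps)
    also have "q powr g * g * x i * (p i / q) \<le> q powr g * g * x i * 1"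
      using p i q x g by (intro mult_left_mono) auto
    finally show "p i * x i powr b \<le> q powr g * (1 - g) * p i + q powr g * g * x i" by simp
  qed
  also have "\<dots> = q powr g * ((1 - g) * sum p I + g * sum x I)"
    by (simp only: sum.distrib sum_distrib_left[symmetric] distrib_left mult.assoc)
  also have "\<dots> \<le> q powr g * ((1 - g) * 1 + g * 1)"
    using p x g by (intro mult_left_mono add_mono) auto
  finally show ?thesis by (simp add: g_def)
qed

text \<open>The worst case is \<open>m = 3\<close>.\<close>

lemma half_le:
  fixes m k :: nat
  assumes "1 < m" "k = m div 2"
  shows "real k \<le> 2 / 3 * real m" "real (m - k) \<le> 2 / 3 * real m"
proof -
  have "3 * k \<le> 2 * m" "3 * (m - k) \<le> 2 * m" using assms by presburger+
  then show "real k \<le> 2 / 3 * real m" "real (m - k) \<le> 2 / 3 * real m" by linarith+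
qed

lemma block_areas_sum:
  fixes k h m n :: nat
  assumes "k \<le> m" "h \<le> n"
  shows "k * h + k * (n - h) + (m - k) * h + (m - k) * (n - h) = m * n"
proof -
  have "m * n = (k + (m - k)) * (h + (n - h))" using assms by simp
  then show ?thesis by (simp only: add_mult_distrib add_mult_distrib2 add.assoc)
qed

text \<open>The instance of \<open>weighted_powr_sum_le\<close> for the fractions of the four quadrants and of the four
  ranks.\<close>

lemma quadrant_sum_le:
  fixes b C :: real and r1 r2 r3 r4 m n k h :: nat
  assumes mn: "1 < m" "1 < n" and k: "k = m div 2" and h: "h = n div 2" and b: "0 < b"
  shows "real k * real h * real r1 powr b + real k * real (n - h) * real r2 powr b
      + real (m - k) * real h * real r3 powr b + real (m - k) * real (n - h) * real r4 powr b
    \<le> (4 / 9) powr min b 1 * real m * real n * real (r1 + r2 + r3 + r4) powr b"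
proof (cases "r1 + r2 + r3 + r4 = 0")
  case True
  then show ?thesis by simp
next
  case False
  define r where "r = real (r1 + r2 + r3 + r4)"
  define S where "S = real m * real n"
  have r: "0 < r" and S: "0 < S" using False mn by (auto simp: r_def S_def)
  note km = half_le[OF mn(1) k] and hn = half_le[OF mn(2) h]
  define p where "p = (\<lambda>i::nat. [real k * real h, real k * real (n - h), real (m - k) * real h,
    real (m - k) * real (n - h)] ! i / S)"
  define x where "x = (\<lambda>i::nat. real ([r1, r2, r3, r4] ! i) / r)"
  have I: "{..<4} = {0, 1, 2, 3::nat}" by auto
  have bound: "u * v / S \<le> 4 / 9" if "u \<le> 2 / 3 * real m" "v \<le> 2 / 3 * real n" "0 \<le> u" "0 \<le> v" for u v
  proof -
    have "u * v \<le> (2 / 3 * real m) * (2 / 3 * real n)" using that by (intro mult_mono) auto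
    then show ?thesis using S by (simp add: S_def field_simps)
  qed
  have "(\<Sum>i\<in>{..<4}. p i * x i powr b) \<le> (4 / 9) powr min b 1"
  proof (rule weighted_powr_sum_le)
    fix i assume "i \<in> {..<4::nat}"
    then show "0 \<le> p i \<and> p i \<le> 4 / 9" "0 \<le> x i"
      using km hn bound S r unfolding I by (auto simp: p_def x_def)
  next
    have "real (k * h + k * (n - h) + (m - k) * h + (m - k) * (n - h)) = S"
      using block_areas_sum[of k m h n] by (simp add: k h S_def)
    then show "sum p {..<4} \<le> 1"
      using S unfolding I by (simp add: p_def field_simps)
    have "sum x {..<4} = real (r1 + r2 + r3 + r4) / r"
      unfolding I by (simp add: x_def add_divide_distrib)
    then show "sum x {..<4} \<le> 1"
      using r by (simp add: r_def)
  qed (use b in auto)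
  then have "S * r powr b * (\<Sum>i\<in>{..<4}. p i * x i powr b) \<le> S * r powr b * (4 / 9) powr min b 1"
    using S by (intro mult_left_mono) auto
  moreover have "S * r powr b * (\<Sum>i\<in>{..<4}. p i * x i powr b)
      = (\<Sum>i\<in>{..<4}. [real k * real h, real k * real (n - h), real (m - k) * real h, real (m - k) * real (n - h)] ! i
          * real ([r1, r2, r3, r4] ! i) powr b)"
  proof -
    have "S * r powr b * (u / S * (real v / r) powr b) = u * real v powr b" for u v
      using S r by (simp add: powr_divide)
    then show ?thesis by (simp only: sum_distrib_left p_def x_def)
  qed
  ultimately have "(\<Sum>i\<in>{..<4}. [real k * real h, real k * real (n - h), real (m - k) * real h, real (m - k) * real (n - h)] ! i
          * real ([r1, r2, r3, r4] ! i) powr b) \<le> S * r powr b * (4 / 9) powr min b 1" by simp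
  then show ?thesis
    unfolding I by (simp add: S_def r_def mult_ac)
qed

section \<open>The bound\<close>

context pluq_routines
begin

lemma pluq_correct:
  "A \<in> carrier_mat m n \<Longrightarrow> pluq_spec m n A (fst (pluq R m n A))"
proof (induction "m + n" arbitrary: m n A rule: less_induct)
  case less
  consider "m = 0 \<or> n = 0" | "m = 1" "n \<noteq> 0" | "n = 1" "m \<noteq> 0" "m \<noteq> 1" | "1 < m" "1 < n" by linarith
  then show ?case
  proof cases
    case 1
    then have "A = 0\<^sub>m m n" using less.prems by (intro eq_matI) auto
    moreover have "pluq R m n A = ret (pluq_zero m n)" by (subst pluq.simps) (use 1 in auto)
    ultimately show ?thesis using pluq_spec_zero[of m n] by simp
  next
    case 2
    have "pluq R m n A = pluq_row n A" by (subst pluq.simps) (use 2 in simp)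
    then show ?thesis using pluq_row_spec[of A n] less.prems 2 by simp
  next
    case 3
    have "pluq R m n A = pluq_col m A" by (subst pluq.simps) (use 3 in simp)
    then show ?thesis using pluq_col_spec(1)[of A m] less.prems 3 by simp
  next
    case 4
    show ?thesis
      by (rule pluq_step[OF less.prems 4(1,2)], rule less.hyps) assumption+
  qed
qed

text \<open>\<open>C\<close> solves \<open>12 (c + 1) + C \<theta> \<le> C\<close>, which is what the induction step needs. The additional \<open>1\<close> makes
  \<open>C \<ge> 1\<close>, which pays for the divisions in the case of a single column.\<close>

lemma pluq_ops:
  defines "\<theta> \<equiv> (4 / 9) powr min (\<omega> - 2) 1"
  defines "C \<equiv> 12 * (c + 1) / (1 - \<theta>) + 1"
  shows "A \<in> carrier_mat m n \<Longrightarrow>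
    real (snd (pluq R m n A)) \<le> C * real m * real n * real (pluq_rank (fst (pluq R m n A))) powr (\<omega> - 2)"
proof (induction "m + n" arbitrary: m n A rule: less_induct)
  case less
  have "\<theta> < 1 powr min (\<omega> - 2) 1"
    unfolding \<theta>_def using omega by (intro powr_less_mono2) auto
  then have \<theta>: "\<theta> < 1" by simp
  have C: "1 \<le> C" "12 * (c + 1) + C * \<theta> \<le> C"
  proof -
    show "1 \<le> C" using \<theta> c by (simp add: C_def)
    have "C * (1 - \<theta>) = 12 * (c + 1) + (1 - \<theta>)" using \<theta> by (simp add: C_def field_simps)
    then show "12 * (c + 1) + C * \<theta> \<le> C" using \<theta> by (simp add: algebra_simps)
  qed
  consider "m = 0 \<or> n = 0" | "m = 1" "n \<noteq> 0" | "n = 1" "m \<noteq> 0" "m \<noteq> 1" | "1 < m" "1 < n" by linarith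
  then show ?case
  proof cases
    case 1
    have "pluq R m n A = ret (pluq_zero m n)" by (subst pluq.simps) (use 1 in auto)
    then show ?thesis using 1 by auto
  next
    case 2
    have "pluq R m n A = pluq_row n A" by (subst pluq.simps) (use 2 in simp)
    moreover have "snd (pluq_row n A) = 0" by (simp add: pluq_row_def Let_def split: prod.split)
    ultimately show ?thesis using 2 C by simp
  next
    case 3
    let ?r = "pluq_rank (fst (pluq_col m A))"
    have col: "pluq R m n A = pluq_col m A" by (subst pluq.simps) (use 3 in simp)
    have "?r \<le> 1"
    proof -
      have "A \<in> carrier_mat m 1" using less.prems 3 by simp
      from pluq_col_spec(1)[OF this] show ?thesis by (cases "fst (pluq_col m A)") auto
    qed
    then have powr: "real ?r powr (\<omega> - 2) = real ?r" using omega by (cases "?r = 0") (auto simp: le_Suc_eq)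
    have "real (snd (pluq_col m A)) \<le> real m * real ?r"
      using pluq_col_spec(2)[of A m] less.prems 3 by (simp flip: of_nat_mult)
    moreover have "1 * (real m * real ?r) \<le> C * (real m * real ?r)"
      using C by (intro mult_right_mono) auto
    ultimately show ?thesis unfolding col powr using 3(1) by (simp add: mult.assoc)
  next
    case 4
    define k h where "k = m div 2" and "h = n div 2"
    have kh: "k < m" "h < n" "0 < k" "0 < h" using 4 by (auto simp: k_def h_def)
    obtain A1 F G W r1 r2 r3 r4 where
      A1: "A1 \<in> carrier_mat k h" "r1 = pluq_rank (fst (pluq R k h A1))" and
      F: "F \<in> carrier_mat (k - r1) (n - h)" "r2 = pluq_rank (fst (pluq R (k - r1) (n - h) F))" and
      G: "G \<in> carrier_mat (m - k) (h - r1)" "r3 = pluq_rank (fst (pluq R (m - k) (h - r1) G))" and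
      W: "W \<in> carrier_mat (m - k - r3) (n - h - r2)" "r4 = pluq_rank (fst (pluq R (m - k - r3) (n - h - r2) W))" and
      r: "pluq_rank (fst (pluq R m n A)) = r1 + r2 + r3 + r4" and
      ops: "real (snd (pluq R m n A)) \<le> real (snd (pluq R k h A1)) + real (snd (pluq R (k - r1) (n - h) F))
       + real (snd (pluq R (m - k) (h - r1) G)) + real (snd (pluq R (m - k - r3) (n - h - r2) W))
       + 12 * (c + 1) * real m * real n * real (r1 + r2 + r3 + r4) powr (\<omega> - 2)"
      by (rule pluq_step[OF less.prems 4 pluq_correct, folded k_def h_def]) blast+
    let ?b = "\<omega> - 2"
    have mono: "C * real a * real b * real s powr ?b \<le> C * (real a' * real b' * real s powr ?b)"
      if "a \<le> a'" "b \<le> b'" for a b a' b' s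
      using that C by (simp add: mult.assoc) (intro mult_left_mono mult_mono; simp)
    have IH: "real (snd (pluq R a b X)) \<le> C * (real a' * real b' * real s powr ?b)"
      if "X \<in> carrier_mat a b" "s = pluq_rank (fst (pluq R a b X))" "a \<le> a'" "b \<le> b'" "a' + b' < m + n" for X a b a' b' s
      using less.hyps[of a b X] that mono[of a a' b b' s] by force
    let ?S = "real k * real h * real r1 powr ?b + real k * real (n - h) * real r2 powr ?b
      + real (m - k) * real h * real r3 powr ?b + real (m - k) * real (n - h) * real r4 powr ?b"
    let ?T = "real m * real n * real (r1 + r2 + r3 + r4) powr ?b"
    \<comment> \<open>Stated for arbitrary reals, so that the products below remain atomic.\<close>
    have IH_sum: "t \<le> b1 + b2 + b3 + b4 + l"
      if "t \<le> a1 + a2 + a3 + a4 + l" "a1 \<le> b1" "a2 \<le> b2" "a3 \<le> b3" "a4 \<le> b4" for t a1 a2 a3 a4 b1 b2 b3 b4 l :: real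
      using that by linarith
    have "real (snd (pluq R m n A)) \<le> C * (real k * real h * real r1 powr ?b) + C * (real k * real (n - h) * real r2 powr ?b)
        + C * (real (m - k) * real h * real r3 powr ?b) + C * (real (m - k) * real (n - h) * real r4 powr ?b)
        + 12 * (c + 1) * real m * real n * real (r1 + r2 + r3 + r4) powr ?b"
      by (rule IH_sum[OF ops IH[OF A1] IH[OF F] IH[OF G] IH[OF W]]) (use kh in auto)
    also have "\<dots> = C * ?S + 12 * (c + 1) * ?T"
      by (simp only: distrib_left[of C] mult.assoc[of "12 * (c + 1)"])
    also have "\<dots> \<le> (12 * (c + 1) + C * \<theta>) * ?T"
    proof -
      have "?S \<le> (4 / 9) powr min ?b 1 * real m * real n * real (r1 + r2 + r3 + r4) powr ?b"
        by (rule quadrant_sum_le[OF 4 k_def h_def]) (use omega in simp)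
      also have "\<dots> = \<theta> * ?T" by (simp only: \<theta>_def mult.assoc)
      finally have "C * ?S \<le> C * (\<theta> * ?T)"
        by (rule mult_left_mono) (use C in simp)
      then have "C * ?S + 12 * (c + 1) * ?T \<le> C * (\<theta> * ?T) + 12 * (c + 1) * ?T"
        by (rule add_right_mono)
      also have "\<dots> = (12 * (c + 1) + C * \<theta>) * ?T"
        by (simp only: distrib_right[of "12 * (c + 1)" "C * \<theta>"] mult.assoc[of C \<theta>])
      finally show ?thesis .
    qed
    also have "\<dots> \<le> C * ?T"
      using C by (intro mult_right_mono) auto
    finally show ?thesis by (simp only: r mult.assoc)
  qed
qed

end

theorem theorem2:
  fixes \<omega> :: real
    and mm :: "nat \<Rightarrow> nat \<Rightarrow> nat \<Rightarrow> 'a::field slp"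
    and lsolve usolve :: "nat \<Rightarrow> nat \<Rightarrow> 'a slp"
  assumes "2 < \<omega>"
    and "mm_routine \<omega> mm"
    and "lower_solve_routine \<omega> lsolve"
    and "upper_solve_routine \<omega> usolve"
  shows "\<exists>C::real. \<forall>m n r. \<forall>A \<in> carrier_mat m n. vec_space.rank m A = r \<longrightarrow>
    real (snd (pluq (mm, lsolve, usolve) m n A)) \<le> C * real m * real n * real r powr (\<omega> - 2)"
proof -
  obtain c1 where c1: "\<And>a s b. s \<le> min a b \<Longrightarrow> real (slp_ops (mm a s b)) \<le> c1 * (real a * real b * real s powr (\<omega> - 2))"
    using assms(2) unfolding mm_routine_def mult.assoc by blast
  obtain c2 where c2: "\<And>s b. s \<le> b \<Longrightarrow> real (slp_ops (lsolve s b)) \<le> c2 * (real b * real s powr (\<omega> - 1))"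
    using assms(3) unfolding lower_solve_routine_def mult.assoc by blast
  obtain c3 where c3: "\<And>s b. s \<le> b \<Longrightarrow> real (slp_ops (usolve s b)) \<le> c3 * (real b * real s powr (\<omega> - 1))"
    using assms(4) unfolding upper_solve_routine_def mult.assoc by blast
  define c where "c = max 0 (max c1 (max c2 c3))"
  then have c_ge: "c1 \<le> c" "c2 \<le> c" "c3 \<le> c" by simp_all
  interpret pluq_routines \<omega> c mm lsolve usolve
  proof
    show "real (slp_ops (mm a s b)) \<le> c * real a * real b * real s powr (\<omega> - 2)" if "s \<le> min a b" for a s b
      using order_trans[OF c1[OF that] mult_right_mono[of c1 c]] c_ge
      by (simp add: mult.assoc)
    show "real (slp_ops (lsolve s b)) \<le> c * real b * real s powr (\<omega> - 1)" if "s \<le> b" for s b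
      using order_trans[OF c2[OF that] mult_right_mono[of c2 c]] c_ge
      by (simp add: mult.assoc)
    show "real (slp_ops (usolve s b)) \<le> c * real b * real s powr (\<omega> - 1)" if "s \<le> b" for s b
      using order_trans[OF c3[OF that] mult_right_mono[of c3 c]] c_ge
      by (simp add: mult.assoc)
  qed (use assms in \<open>auto simp: c_def\<close>)
  define C where "C = 12 * (c + 1) / (1 - (4 / 9) powr min (\<omega> - 2) 1) + 1"
  \<comment> \<open>The absolute value makes the right-hand side monotone in the rank.\<close>
  have "real (snd (pluq R m n A)) \<le> \<bar>C\<bar> * real m * real n * real (vec_space.rank m A) powr (\<omega> - 2)"
    if A: "A \<in> carrier_mat m n" for m n A
  proof -
    let ?s = "pluq_rank (fst (pluq R m n A))"
    have "real ?s powr (\<omega> - 2) \<le> real (vec_space.rank m A) powr (\<omega> - 2)"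
      using pluq_spec_rank[OF pluq_correct[OF A]] assms(1) by (intro powr_mono2) auto
    then have "C * (real m * real n * real ?s powr (\<omega> - 2))
        \<le> \<bar>C\<bar> * (real m * real n * real (vec_space.rank m A) powr (\<omega> - 2))"
      by (intro mult_mono) auto
    then show ?thesis
      using pluq_ops[OF A] by (simp add: C_def mult.assoc)
  qed
  then show ?thesis by blast
qed

end
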